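(* Let $d\ge 2$ and $r\in\mathbb N$. There is a constant $C(r,d)>0$, depending only on $r$ and $d$, such that for every $m\in\mathbb N$ and every cubature formula $(\xi,\Lambda)$ with $m$ knots $\xi=(\xi^1,\dots,\xi^m)$, $\xi^\mu\in[0,1)^d$, and weights $\Lambda=(\lambda_1,\dots,\lambda_m)$, $$\tilde D^{r}_{2,2}(\xi,\Lambda)\ \ge\ C(r,d)\, m^{-r}(\log m)^{(d-1)/2}.$$
   Context: A cubature formula $(\xi,\Lambda)$ with $m$ knots consists of points $\xi^1,\dots,\xi^m\in[0,1)^d$ and real weights $\lambda_1,\dots,\lambda_m$ (no positivity or normalization is assumed). Hat functions. For $u>0$, $x\in\mathbb R$, let $h^1(x,u):=\chi_{[-u/2,u/2)}(x)$ (characteristic function) and, for $r\ge2$, $h^r(\cdot,u):=h^{r-1}(\cdot,u)\ast h^1(\cdot,u)$, where $(f\ast g)(x)=\int_{\mathbb R}f(x-y)g(y)\,dy$. For $\mathbf x\in\mathbb R^d$, $\mathbf z\in[0,1)^d$, $\mathbf u\in(0,1/2]^d$ let $h^r(\mathbf x,\mathbf z,\mathbf u):=\prod_{j=1}^d h^r(x_j-z_j,u_j)$, and let $\tilde h^r(\mathbf x,\mathbf z,\mathbf u):=\sum_{\mathbf n\in\mathbb Z^d}h^r(\mathbf n+\mathbf x,\mathbf z,\mathbf u)$ be its periodization in $\mathbf x$ with period $1$ in each variable. Periodic $r$-smooth $L_{\mathbf p}$-discrepancy. For $1\le p_1,p_2\le\infty$, $$\tilde D^{r}_{p_1,p_2}(\xi,\Lambda):=\left\|\,\Big\|\int_{[0,1)^d}\tilde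 h^r(\mathbf x,\mathbf z,\mathbf u)\,d\mathbf x-\sum_{\mu=1}^m\lambda_\mu\tilde h^r(\xi^\mu,\mathbf z,\mathbf u)\Big\|_{p_1}\right\|_{p_2},$$ where the inner $L_{p_1}$ norm is in $\mathbf z$ over $[0,1)^d$ and the outer $L_{p_2}$ norm is in $\mathbf u$ over $(0,1/2]^d$, both with respect to Lebesgue measure. *)

theory Defs
  imports "HOL-Probability.Essential_Supremum"
begin

definition unit_cube :: "(real^'d) set" where
  "unit_cube = {x. \<forall>j. 0 \<le> x $ j \<and> x $ j < 1}"

definition half_cube :: "(real^'d) set" where
  "half_cube = {u. \<forall>j. 0 < u $ j \<and> u $ j \<le> 1/2}"

definition convolve :: "(real \<Rightarrow> real) \<Rightarrow> (real \<Rightarrow> real) \<Rightarrow> real \<Rightarrow> real" where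
  "convolve f g x = (LINT y|lborel. f (x - y) * g y)"

definition hat1 :: "real \<Rightarrow> real \<Rightarrow> real" where
  "hat1 x u = indicator {-u/2..<u/2} x"

text \<open>The hat functions are defined for smoothness \<open>r \<ge> 1\<close>; the value at \<open>r = 0\<close> is a dummy.\<close>

fun hat :: "nat \<Rightarrow> real \<Rightarrow> real \<Rightarrow> real" where
  "hat 0 x u = 0"
| "hat (Suc 0) x u = hat1 x u"
| "hat (Suc (Suc r)) x u = convolve (\<lambda>t. hat (Suc r) t u) (\<lambda>t. hat1 t u) x"

definition hat_prod :: "nat \<Rightarrow> real^'d \<Rightarrow> real^'d \<Rightarrow> real^'d \<Rightarrow> real" where
  "hat_prod r x z u = (\<Prod>j\<in>UNIV. hat r (x $ j - z $ j) (u $ j))"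

text \<open>For fixed arguments only finitely many terms of the sum are nonzero, since every hat function
  has bounded support.\<close>

definition periodic_hat :: "nat \<Rightarrow> real^'d \<Rightarrow> real^'d \<Rightarrow> real^'d \<Rightarrow> real" where
  "periodic_hat r x z u = (\<Sum>\<^sub>\<infinity>n\<in>(UNIV :: (int^'d) set). hat_prod r ((\<chi> j. of_int (n $ j)) + x) z u)"

text \<open>The \<open>L\<^sub>p\<close> norm for \<open>1 \<le> p \<le> \<infinity>\<close>. It is real-valued, hence meaningful only for functions
  that are in \<open>L\<^sub>p\<close>; below it is applied to bounded measurable functions on sets of finite measure.\<close>

definition Lp_norm :: "'a measure \<Rightarrow> ereal \<Rightarrow> ('a \<Rightarrow> real) \<Rightarrow> real" where
  "Lp_norm M p f =
     (if p = \<infinity> then real_of_ereal (esssup M (\<lambda>x. ereal \<bar>f x\<bar>))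
      else (LINT x|M. \<bar>f x\<bar> powr real_of_ereal p) powr (1 / real_of_ereal p))"

definition cubature_error ::
  "nat \<Rightarrow> nat \<Rightarrow> (nat \<Rightarrow> real^'d) \<Rightarrow> (nat \<Rightarrow> real) \<Rightarrow> real^'d \<Rightarrow> real^'d \<Rightarrow> real" where
  "cubature_error r m \<xi> w z u =
     (LINT x:unit_cube|lborel. periodic_hat r x z u) - (\<Sum>\<mu>=1..m. w \<mu> * periodic_hat r (\<xi> \<mu>) z u)"

definition periodic_discrepancy ::
  "nat \<Rightarrow> ereal \<Rightarrow> ereal \<Rightarrow> nat \<Rightarrow> (nat \<Rightarrow> real^'d) \<Rightarrow> (nat \<Rightarrow> real) \<Rightarrow> real" where
  "periodic_discrepancy r p1 p2 m \<xi> w =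
     Lp_norm (restrict_space lborel half_cube) p2
       (\<lambda>u. Lp_norm (restrict_space lborel unit_cube) p1 (\<lambda>z. cubature_error r m \<xi> w z u))"

end

theory Submission
  imports Defs
begin

text \<open>
  Up to constants, the squared discrepancy is the sum of \<open>\<bar>\<nu> k\<bar>\<^sup>2\<close> with weights
  \<open>(\<Prod>j. max 1 \<bar>k\<^sub>j\<bar>)\<close> to the power \<open>- 2 r\<close>, where \<open>\<nu> k\<close> are the Fourier coefficients of the measure
  \<open>dx - (\<Sum>\<mu>. w \<mu> \<delta>\<^bsub>\<xi> \<mu>\<^esub>)\<close>. Only the lower bound for finitely many frequencies is needed; it follows
  from Bessel's inequality in \<open>z\<close> and an integration over \<open>u\<close>.

  Let \<open>4 m \<le> 2 ^ n \<le> 8 m\<close>. For every \<open>s\<close> with \<open>(\<Sum>j. s j) = n\<close> put \<open>N = 2 ^ n\<close> and let \<open>l, l'\<close> range over the \<open>N\<close> integer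
  points of the box with side lengths \<open>2 ^ s j\<close>. The matrix with entries \<open>Re (\<nu> (l - l'))\<close> is the
  identity minus a matrix of rank at most \<open>2 m\<close>, so its squared Frobenius norm is at least
  \<open>N - 2 m \<ge> N / 2\<close>. Each difference \<open>l - l'\<close> occurs at most \<open>N\<close> times, hence the sum of \<open>\<bar>\<nu> k\<bar>\<^sup>2\<close> over
  \<open>\<bar>k j\<bar> < 2 ^ s j\<close> is at least \<open>1/2\<close>. Summation over the order of \<open>n ^ (d - 1)\<close> many \<open>s\<close> gives the
  power of the logarithm, because the number of boxes containing \<open>k\<close> is at most a constant times
  \<open>2 ^ (2 r n)\<close> times the weight of \<open>k\<close>.
\<close>

section \<open>Distance of the identity to matrices of low rank\<close>

text \<open>Gram-Schmidt for functions on the finite set \<open>L\<close>. A vector that depends on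
  the earlier ones yields the zero vector instead of being dropped. This keeps the index set equal
  to \<open>I\<close> and is why squared norms may be 0 as well as 1.\<close>

lemma exists_orthonormal_spanning:
  fixes v :: "'i \<Rightarrow> 'a \<Rightarrow> real"
  assumes "finite L" "finite I"
  shows "\<exists>q. (\<forall>i\<in>I. \<forall>j\<in>I. i \<noteq> j \<longrightarrow> (\<Sum>x\<in>L. q i x * q j x) = 0) \<and>
    (\<forall>i\<in>I. (\<Sum>x\<in>L. (q i x)\<^sup>2) \<in> {0, 1}) \<and>
    (\<forall>i\<in>I. \<exists>c. \<forall>x\<in>L. v i x = (\<Sum>j\<in>I. c j * q j x))"
  using \<open>finite I\<close>
proof (induction I)
  case empty
  show ?case by simp
next
  case (insert n I)
  from insert.IH obtain q where q: "(\<forall>i\<in>I. \<forall>j\<in>I. i \<noteq> j \<longrightarrow> (\<Sum>x\<in>L. q i x * q j x) = 0) \<and>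
    (\<forall>i\<in>I. (\<Sum>x\<in>L. (q i x)\<^sup>2) \<in> {0, 1}) \<and>
    (\<forall>i\<in>I. \<exists>c. \<forall>x\<in>L. v i x = (\<Sum>j\<in>I. c j * q j x))" ..
  have orth: "(\<Sum>x\<in>L. q i x * q j x) = 0" if "i \<in> I" "j \<in> I" "i \<noteq> j" for i j
    using q that by blast
  have nrm: "(\<Sum>x\<in>L. (q i x)\<^sup>2) \<in> {0, 1}" if "i \<in> I" for i
    using q that by blast
  have spn: "\<exists>c. \<forall>x\<in>L. v i x = (\<Sum>j\<in>I. c j * q j x)" if "i \<in> I" for i
    using q that by blast
  define b where "b j = (\<Sum>x\<in>L. v n x * q j x)" for j
  define p where "p x = v n x - (\<Sum>j\<in>I. b j * q j x)" for x
  define s where "s = (\<Sum>x\<in>L. (p x)\<^sup>2)"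
  \<comment> \<open>If \<open>s = 0\<close>, division by zero makes the new vector 0, as wanted for
    a dependent \<open>v n\<close>.\<close>
  define q' where "q' = q(n := (\<lambda>x. p x / sqrt s))"
  have s0: "s \<ge> 0" by (simp add: s_def sum_nonneg)
  have q'n: "q' n x = p x / sqrt s" for x by (simp add: q'_def)
  have q'I: "i \<in> I \<Longrightarrow> q' i = q i" for i using insert.hyps by (auto simp: q'_def)
  have pq: "(\<Sum>x\<in>L. p x * q i x) = 0" if i: "i \<in> I" for i
  proof -
    have "(\<Sum>x\<in>L. p x * q i x) = b i - (\<Sum>x\<in>L. \<Sum>j\<in>I. b j * (q j x * q i x))"
      unfolding b_def[of i] by (simp add: p_def left_diff_distrib sum_subtractf sum_distrib_right mult.assoc)
    also have "(\<Sum>x\<in>L. \<Sum>j\<in>I. b j * (q j x * q i x)) = (\<Sum>j\<in>I. b j * (\<Sum>x\<in>L. q j x * q i x))"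
      by (subst sum.swap) (simp add: sum_distrib_left)
    also have "\<dots> = (\<Sum>j\<in>{i}. b j * (\<Sum>x\<in>L. q j x * q i x))"
      using i insert.hyps orth by (intro sum.mono_neutral_right) auto
    also have "\<dots> = b i * (\<Sum>x\<in>L. (q i x)\<^sup>2)" by (simp add: power2_eq_square)
    \<comment> \<open>If \<open>q i\<close> has norm 0, it vanishes on \<open>L\<close> and so does
      \<open>b i\<close>; otherwise its norm is 1.\<close>
    also have "b i - \<dots> = 0"
    proof (cases "(\<Sum>x\<in>L. (q i x)\<^sup>2) = 0")
      case True
      then have "\<forall>x\<in>L. q i x = 0" using assms(1) by (simp add: sum_nonneg_eq_0_iff)
      then show ?thesis using True by (simp add: b_def)
    next
      case False
      then show ?thesis using nrm[OF i] by simp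
    qed
    finally show ?thesis .
  qed
  have q'n_q: "(\<Sum>x\<in>L. q' n x * q' i x) = 0" "(\<Sum>x\<in>L. q' i x * q' n x) = 0" if "i \<in> I" for i
    using pq[OF that] that by (simp_all add: q'n q'I sum_divide_distrib[symmetric] mult.commute)
  have orth': "(\<Sum>x\<in>L. q' i x * q' j x) = 0" if "i \<in> insert n I" "j \<in> insert n I" "i \<noteq> j" for i j
    using that q'n_q orth by (auto simp: q'I)
  have nrm': "(\<Sum>x\<in>L. (q' i x)\<^sup>2) \<in> {0, 1}" if "i \<in> insert n I" for i
  proof (cases "i = n")
    case True
    \<comment> \<open>The quotient is 0 for \<open>s = 0\<close> and 1 otherwise, so both cases are
      covered.\<close>
    have "(\<Sum>x\<in>L. (q' n x)\<^sup>2) = s / s"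
      using s0 by (simp add: q'n power_divide sum_divide_distrib[symmetric] s_def[symmetric])
    then show ?thesis using True by auto
  next
    case False
    then show ?thesis using that nrm by (auto simp: q'I)
  qed
  have spn': "\<exists>c. \<forall>x\<in>L. v i x = (\<Sum>j\<in>insert n I. c j * q' j x)" if "i \<in> insert n I" for i
  proof (cases "i = n")
    case True
    have p_eq: "p x = sqrt s * q' n x" if "x \<in> L" for x
    proof (cases "s = 0")
      case True
      then show ?thesis using that assms(1) by (simp add: s_def sum_nonneg_eq_0_iff)
    qed (use s0 in \<open>simp add: q'n\<close>)
    have "v n x = (\<Sum>j\<in>insert n I. (b(n := sqrt s)) j * q' j x)" if "x \<in> L" for x
    proof -
      have "(\<Sum>j\<in>I. (b(n := sqrt s)) j * q' j x) = (\<Sum>j\<in>I. b j * q j x)"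
        using insert.hyps by (intro sum.cong) (auto simp: q'I)
      then show ?thesis using p_eq[OF that] insert.hyps by (simp add: p_def)
    qed
    then show ?thesis using True by blast
  next
    case False
    then have "i \<in> I" using that by simp
    from spn[OF this] obtain c where c: "\<forall>x\<in>L. v i x = (\<Sum>j\<in>I. c j * q j x)" ..
    have "v i x = (\<Sum>j\<in>insert n I. (c(n := 0)) j * q' j x)" if "x \<in> L" for x
    proof -
      have "(\<Sum>j\<in>I. (c(n := 0)) j * q' j x) = (\<Sum>j\<in>I. c j * q j x)"
        using insert.hyps by (intro sum.cong) (auto simp: q'I)
      then show ?thesis using c that insert.hyps by simp
    qed
    then show ?thesis by blast
  qed
  show ?case using orth' nrm' spn' by (intro exI[of _ q'] conjI ballI impI)
qed

text \<open>Expanding the square and using orthogonality separates the coefficients; each one is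
  handled by completing the square. The right-hand side is the squared distance of \<open>b\<close>
  to the span of the \<open>q j\<close>. Vectors of norm 0 contribute nothing.\<close>

lemma sum_square_dist_ge:
  fixes q :: "'i \<Rightarrow> 'a \<Rightarrow> real"
  assumes "finite L" "finite I"
    and orth: "\<And>i j. i \<in> I \<Longrightarrow> j \<in> I \<Longrightarrow> i \<noteq> j \<Longrightarrow> (\<Sum>x\<in>L. q i x * q j x) = 0"
    and nrm: "\<And>i. i \<in> I \<Longrightarrow> (\<Sum>x\<in>L. (q i x)\<^sup>2) \<in> {0, 1}"
  shows "(\<Sum>x\<in>L. (b x - (\<Sum>j\<in>I. c j * q j x))\<^sup>2)
    \<ge> (\<Sum>x\<in>L. (b x)\<^sup>2) - (\<Sum>j\<in>I. (\<Sum>x\<in>L. b x * q j x)\<^sup>2)"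
proof -
  define \<beta> where "\<beta> j = (\<Sum>x\<in>L. b x * q j x)" for j
  define \<sigma> where "\<sigma> j = (\<Sum>x\<in>L. (q j x)\<^sup>2)" for j
  have cross: "(\<Sum>x\<in>L. b x * (\<Sum>j\<in>I. c j * q j x)) = (\<Sum>j\<in>I. c j * \<beta> j)"
    by (simp add: \<beta>_def sum_distrib_left) (subst sum.swap, simp add: algebra_simps)
  have "(\<Sum>x\<in>L. (\<Sum>j\<in>I. c j * q j x)\<^sup>2) = (\<Sum>x\<in>L. \<Sum>i\<in>I. \<Sum>j\<in>I. c i * c j * (q i x * q j x))"
    by (simp add: power2_eq_square sum_product algebra_simps)
  also have "\<dots> = (\<Sum>i\<in>I. \<Sum>j\<in>I. \<Sum>x\<in>L. c i * c j * (q i x * q j x))"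
    by (subst sum.swap, rule sum.cong[OF refl], subst sum.swap, rule refl)
  also have "\<dots> = (\<Sum>i\<in>I. \<Sum>j\<in>I. c i * c j * (\<Sum>x\<in>L. q i x * q j x))"
    by (simp add: sum_distrib_left)
  also have "\<dots> = (\<Sum>i\<in>I. \<Sum>j\<in>{i}. c i * c j * (\<Sum>x\<in>L. q i x * q j x))"
    using assms(2) orth by (intro sum.cong[OF refl] sum.mono_neutral_right) auto
  also have "\<dots> = (\<Sum>i\<in>I. (c i)\<^sup>2 * \<sigma> i)" by (simp add: power2_eq_square \<sigma>_def)
  finally have sq: "(\<Sum>x\<in>L. (\<Sum>j\<in>I. c j * q j x)\<^sup>2) = (\<Sum>i\<in>I. (c i)\<^sup>2 * \<sigma> i)" .
  have "(\<Sum>x\<in>L. (b x - (\<Sum>j\<in>I. c j * q j x))\<^sup>2)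
    = (\<Sum>x\<in>L. (b x)\<^sup>2) - 2 * (\<Sum>j\<in>I. c j * \<beta> j) + (\<Sum>i\<in>I. (c i)\<^sup>2 * \<sigma> i)"
    unfolding cross[symmetric] sq[symmetric]
    by (simp add: power2_diff sum.distrib sum_subtractf sum_distrib_left mult.assoc)
  also have "\<dots> = (\<Sum>x\<in>L. (b x)\<^sup>2) + (\<Sum>j\<in>I. (c j)\<^sup>2 * \<sigma> j - 2 * (c j * \<beta> j))"
    by (simp add: sum_subtractf sum_distrib_left)
  also have "\<dots> \<ge> (\<Sum>x\<in>L. (b x)\<^sup>2) + (\<Sum>j\<in>I. - (\<beta> j)\<^sup>2)"
  proof (intro add_left_mono sum_mono)
    fix j assume j: "j \<in> I"
    show "- (\<beta> j)\<^sup>2 \<le> (c j)\<^sup>2 * \<sigma> j - 2 * (c j * \<beta> j)"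
    proof (cases "\<sigma> j = 0")
      case True
      then have "\<forall>x\<in>L. q j x = 0" using assms(1) by (simp add: \<sigma>_def sum_nonneg_eq_0_iff)
      then show ?thesis using True by (simp add: \<beta>_def)
    next
      case False
      then have "\<sigma> j = 1" using nrm[OF j] by (simp add: \<sigma>_def)
      then show ?thesis using zero_le_power2[of "c j - \<beta> j"] by (simp add: power2_diff)
    qed
  qed
  finally show ?thesis by (simp add: \<beta>_def sum_negf)
qed

text \<open>Every row of the subtracted matrix lies in the span of the \<open>v i\<close>. Row
  \<open>l\<close> of the identity is a unit vector, whose squared distance to that span is at least
  \<open>1 - (\<Sum>j\<in>I. (q j l)\<^sup>2)\<close>. Summed over \<open>l\<close>, the subtracted
  terms become the squared norms of the \<open>q j\<close>, each at most 1.\<close>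

lemma frobenius_dist_low_rank:
  fixes a v :: "'i \<Rightarrow> 'a \<Rightarrow> real"
  assumes "finite L" "finite I"
  shows "(\<Sum>l\<in>L. \<Sum>x\<in>L. (of_bool (l = x) - (\<Sum>i\<in>I. a i l * v i x))\<^sup>2) \<ge> real (card L) - real (card I)"
proof -
  from exists_orthonormal_spanning[OF assms, of v]
  obtain q where q: "(\<forall>i\<in>I. \<forall>j\<in>I. i \<noteq> j \<longrightarrow> (\<Sum>x\<in>L. q i x * q j x) = 0) \<and>
    (\<forall>i\<in>I. (\<Sum>x\<in>L. (q i x)\<^sup>2) \<in> {0, 1}) \<and>
    (\<forall>i\<in>I. \<exists>c. \<forall>x\<in>L. v i x = (\<Sum>j\<in>I. c j * q j x))" ..
  have orth: "(\<Sum>x\<in>L. q i x * q j x) = 0" if "i \<in> I" "j \<in> I" "i \<noteq> j" for i j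
    using q that by blast
  have nrm: "(\<Sum>x\<in>L. (q i x)\<^sup>2) \<in> {0, 1}" if "i \<in> I" for i
    using q that by blast
  from q have "\<forall>i\<in>I. \<exists>c. \<forall>x\<in>L. v i x = (\<Sum>j\<in>I. c j * q j x)" by (elim conjE)
  from bchoice[OF this]
  obtain c where "\<forall>i\<in>I. \<forall>x\<in>L. v i x = (\<Sum>j\<in>I. c i j * q j x)" ..
  then have c: "v i x = (\<Sum>j\<in>I. c i j * q j x)" if "i \<in> I" "x \<in> L" for i x using that by blast
  have "(\<Sum>x\<in>L. (of_bool (l = x) - (\<Sum>i\<in>I. a i l * v i x))\<^sup>2) \<ge> 1 - (\<Sum>j\<in>I. (q j l)\<^sup>2)"
    if l: "l \<in> L" for l
  proof -
    have "(\<Sum>i\<in>I. a i l * v i x) = (\<Sum>j\<in>I. (\<Sum>i\<in>I. a i l * c i j) * q j x)" if "x \<in> L" for x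
    proof -
      have "(\<Sum>i\<in>I. a i l * v i x) = (\<Sum>i\<in>I. \<Sum>j\<in>I. a i l * c i j * q j x)"
        using that c by (simp add: sum_distrib_left mult.assoc)
      then show ?thesis by (subst (asm) sum.swap) (simp add: sum_distrib_right)
    qed
    then have "(\<Sum>x\<in>L. (of_bool (l = x) - (\<Sum>i\<in>I. a i l * v i x))\<^sup>2)
      = (\<Sum>x\<in>L. (of_bool (l = x) - (\<Sum>j\<in>I. (\<Sum>i\<in>I. a i l * c i j) * q j x))\<^sup>2)"
      by (intro sum.cong) auto
    also have "\<dots> \<ge> (\<Sum>x\<in>L. (of_bool (l = x))\<^sup>2) - (\<Sum>j\<in>I. (\<Sum>x\<in>L. of_bool (l = x) * q j x)\<^sup>2)"
      by (rule sum_square_dist_ge[OF assms orth nrm])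
    finally have ge: "(\<Sum>x\<in>L. (of_bool (l = x))\<^sup>2) - (\<Sum>j\<in>I. (\<Sum>x\<in>L. of_bool (l = x) * q j x)\<^sup>2)
      \<le> (\<Sum>x\<in>L. (of_bool (l = x) - (\<Sum>i\<in>I. a i l * v i x))\<^sup>2)" .
    have delta: "(\<Sum>x\<in>L. of_bool (l = x) * g x) = g l" for g :: "'a \<Rightarrow> real"
    proof -
      have "(\<Sum>x\<in>L. of_bool (l = x) * g x) = (\<Sum>x\<in>L. if l = x then g x else 0)"
        by (intro sum.cong) auto
      then show ?thesis using l assms(1) by simp
    qed
    have "(\<Sum>x\<in>L. (of_bool (l = x) :: real)\<^sup>2) = 1"
      using delta[of "\<lambda>x. of_bool (l = x)"] by (simp add: power2_eq_square)
    then show ?thesis using ge by (simp add: delta)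
  qed
  then have "(\<Sum>l\<in>L. \<Sum>x\<in>L. (of_bool (l = x) - (\<Sum>i\<in>I. a i l * v i x))\<^sup>2) \<ge> (\<Sum>l\<in>L. 1 - (\<Sum>j\<in>I. (q j l)\<^sup>2))"
    by (intro sum_mono)
  also have "(\<Sum>l\<in>L. 1 - (\<Sum>j\<in>I. (q j l)\<^sup>2)) = real (card L) - (\<Sum>j\<in>I. \<Sum>l\<in>L. (q j l)\<^sup>2)"
    by (simp add: sum_subtractf) (rule sum.swap)
  finally have "real (card L) - (\<Sum>j\<in>I. \<Sum>l\<in>L. (q j l)\<^sup>2)
    \<le> (\<Sum>l\<in>L. \<Sum>x\<in>L. (of_bool (l = x) - (\<Sum>i\<in>I. a i l * v i x))\<^sup>2)" .
  moreover have "(\<Sum>j\<in>I. \<Sum>l\<in>L. (q j l)\<^sup>2) \<le> (\<Sum>j\<in>I. 1)"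
  proof (intro sum_mono)
    show "(\<Sum>l\<in>L. (q j l)\<^sup>2) \<le> 1" if "j \<in> I" for j using nrm[OF that] by auto
  qed
  ultimately show ?thesis by simp
qed

section \<open>Exponential sums over dyadic frequency boxes\<close>

definition freq_box :: "('d \<Rightarrow> nat) \<Rightarrow> ('d \<Rightarrow> int) set" where
  "freq_box s = {k. \<forall>j. \<bar>k j\<bar> < 2 ^ s j}"

lemma finite_freq_box: "finite (freq_box (s :: 'd::finite \<Rightarrow> nat))"
proof -
  have "freq_box s \<subseteq> PiE UNIV (\<lambda>j. {- (2 ^ s j)..2 ^ s j})"
  proof
    fix k assume "k \<in> freq_box s"
    then have "\<bar>k j\<bar> < 2 ^ s j" for j by (simp add: freq_box_def)
    then have "k j \<in> {- (2 ^ s j)..2 ^ s j}" for j by (simp add: abs_less_iff) (smt (verit))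
    then show "k \<in> PiE UNIV (\<lambda>j. {- (2 ^ s j)..2 ^ s j})" by blast
  qed
  then show ?thesis by (rule finite_subset) (simp add: finite_PiE)
qed

text \<open>The matrix of entries \<open>\<nu> (l - l')\<close> is the identity minus a matrix of rank at most \<open>2 m\<close>.\<close>

lemma sum_freq_box_ge_half:
  fixes s :: "'d::finite \<Rightarrow> nat" and m :: nat and t :: "nat \<Rightarrow> 'd \<Rightarrow> real" and w :: "nat \<Rightarrow> real"
  defines "\<nu> \<equiv> \<lambda>k :: 'd \<Rightarrow> int. of_bool (k = (\<lambda>_. 0)) -
    (\<Sum>\<mu>=1..m. w \<mu> * cos (2 * pi * (\<Sum>j\<in>UNIV. of_int (k j) * t \<mu> j)))"
  assumes m: "4 * m \<le> 2 ^ (\<Sum>j\<in>UNIV. s j)"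
  shows "(\<Sum>k\<in>freq_box s. (\<nu> k)\<^sup>2) \<ge> 1 / 2"
proof -
  define L where "L = PiE UNIV (\<lambda>j. {0..<2 ^ s j :: int})"
  define N where "N = (2 :: nat) ^ (\<Sum>j\<in>UNIV. s j)"
  have finL: "finite L" by (auto simp: L_def intro: finite_PiE)
  have cardL: "card L = N"
    by (simp add: L_def card_PiE N_def power_sum nat_power_eq)
  define \<theta> where "\<theta> \<mu> k = 2 * pi * (\<Sum>j\<in>UNIV. of_int (k j) * t \<mu> j)" for \<mu> and k :: "'d \<Rightarrow> int"
  \<comment> \<open>By the addition formula, \<open>cos (a - b)\<close> is a sum of two products.
    Each knot therefore contributes two terms of rank one, a cosine and a sine term, and the index
    set \<open>I\<close> has \<open>2 * m\<close> elements.\<close>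
  define v where "v = (\<lambda>(\<mu>, c) k. if c then cos (\<theta> \<mu> k) else sin (\<theta> \<mu> k))"
  define I where "I = {1..m} \<times> (UNIV :: bool set)"
  have \<nu>_diff: "\<nu> (\<lambda>j. l j - x j) = of_bool (l = x) - (\<Sum>i\<in>I. w (fst i) * v i l * v i x)" for l x
  proof -
    have \<theta>_diff: "\<theta> \<mu> (\<lambda>j. l j - x j) = \<theta> \<mu> l - \<theta> \<mu> x" for \<mu>
      by (simp add: \<theta>_def left_diff_distrib sum_subtractf right_diff_distrib)
    have "(\<Sum>\<mu>=1..m. w \<mu> * cos (\<theta> \<mu> (\<lambda>j. l j - x j))) = (\<Sum>\<mu>=1..m. \<Sum>c\<in>UNIV. w \<mu> * v (\<mu>, c) l * v (\<mu>, c) x)"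
      unfolding \<theta>_diff by (simp add: UNIV_bool v_def cos_diff algebra_simps)
    also have "\<dots> = (\<Sum>i\<in>I. w (fst i) * v i l * v i x)"
      unfolding I_def sum.cartesian_product by (simp add: case_prod_beta)
    moreover have "(\<lambda>j. l j - x j) = (\<lambda>_. 0) \<longleftrightarrow> l = x" by (auto simp: fun_eq_iff)
    ultimately show ?thesis by (simp add: \<nu>_def \<theta>_def)
  qed
  have "real N - 2 * real m \<le> (\<Sum>l\<in>L. \<Sum>x\<in>L. (\<nu> (\<lambda>j. l j - x j))\<^sup>2)"
    using frobenius_dist_low_rank[OF finL, of I "\<lambda>i l. w (fst i) * v i l" v]
    unfolding \<nu>_diff cardL by (simp add: I_def card_cartesian_product)
  \<comment> \<open>For fixed \<open>l\<close> the differences \<open>l - x\<close> are distinct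
    elements of the frequency box, so each row sum is at most the sum over the whole box.\<close>
  also have "\<dots> \<le> (\<Sum>l\<in>L. \<Sum>k\<in>freq_box s. (\<nu> k)\<^sup>2)"
  proof (intro sum_mono)
    fix l assume l: "l \<in> L"
    have inj: "inj_on (\<lambda>x j. l j - x j) L" by (auto simp: inj_on_def fun_eq_iff)
    have "(\<Sum>x\<in>L. (\<nu> (\<lambda>j. l j - x j))\<^sup>2) = (\<Sum>k\<in>(\<lambda>x j. l j - x j) ` L. (\<nu> k)\<^sup>2)"
      by (subst sum.reindex[OF inj]) simp
    also have "\<dots> \<le> (\<Sum>k\<in>freq_box s. (\<nu> k)\<^sup>2)"
    proof (intro sum_mono2 finite_freq_box)
      show "(\<lambda>x j. l j - x j) ` L \<subseteq> freq_box s"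
      proof (clarsimp simp: freq_box_def)
        fix x j assume "x \<in> L"
        then have "x j \<in> {0..<2 ^ s j}" "l j \<in> {0..<2 ^ s j}" using l by (auto simp: L_def)
        then show "\<bar>l j - x j\<bar> < 2 ^ s j" by auto
      qed
    qed auto
    finally show "(\<Sum>x\<in>L. (\<nu> (\<lambda>j. l j - x j))\<^sup>2) \<le> (\<Sum>k\<in>freq_box s. (\<nu> k)\<^sup>2)" .
  qed
  also have "\<dots> = real N * (\<Sum>k\<in>freq_box s. (\<nu> k)\<^sup>2)" by (simp add: cardL)
  finally have "real N - 2 * real m \<le> real N * (\<Sum>k\<in>freq_box s. (\<nu> k)\<^sup>2)" .
  moreover have "4 * real m \<le> real N" using of_nat_mono[OF m, where 'a = real] by (simp add: N_def)
  ultimately have "real N * (1 / 2) \<le> real N * (\<Sum>k\<in>freq_box s. (\<nu> k)\<^sup>2)" by simp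
  moreover have "real N > 0" by (simp add: N_def)
  ultimately show ?thesis by (simp add: mult_le_cancel_left)
qed

section \<open>Counting dyadic boxes\<close>

text \<open>Weak compositions: zero parts are allowed. They index the integer boxes with side
  lengths \<open>2 ^ s j\<close> that contain exactly \<open>2 ^ n\<close> points.\<close>

definition compositions :: "nat \<Rightarrow> ('d \<Rightarrow> nat) set" where
  "compositions n = {s. (\<Sum>j\<in>UNIV. s j) = n}"

lemma compositions_subset: "compositions n \<subseteq> PiE (UNIV :: 'd::finite set) (\<lambda>_. {..n})"
proof
  fix s :: "'d \<Rightarrow> nat" assume "s \<in> compositions n"
  then have "(\<Sum>j\<in>UNIV. s j) = n" by (simp add: compositions_def)
  then have "s j \<le> n" for j using member_le_sum[of j UNIV s] by auto
  then show "s \<in> PiE UNIV (\<lambda>_. {..n})" by auto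
qed

lemma finite_compositions: "finite (compositions n :: ('d::finite \<Rightarrow> nat) set)"
  by (rule finite_subset[OF compositions_subset]) (simp add: finite_PiE)

text \<open>All coordinates but one can be chosen freely in \<open>{..n div CARD('d)}\<close>; their
  sum does not exceed \<open>n\<close>, and the remaining coordinate makes up the
  difference.\<close>

lemma card_compositions_ge:
  "(n div CARD('d) + 1) ^ (CARD('d) - 1) \<le> card (compositions n :: ('d::finite \<Rightarrow> nat) set)"
proof -
  fix i :: 'd
  define q where "q = n div CARD('d)"
  define A where "A = PiE (UNIV - {i}) (\<lambda>_. {..q})"
  define F where "F f = f(i := n - (\<Sum>j\<in>UNIV - {i}. f j))" for f :: "'d \<Rightarrow> nat"
  have "card A = (q + 1) ^ (CARD('d) - 1)"
    by (simp add: A_def card_PiE)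
  moreover have "inj_on F A"
  proof (rule inj_onI)
    fix f g assume "f \<in> A" "g \<in> A" "F f = F g"
    then have "f j = g j" if "j \<noteq> i" for j using that by (metis F_def fun_upd_other)
    \<comment> \<open>Functions in \<open>A\<close> are extensional, so both are
      \<open>undefined\<close> at \<open>i\<close>.\<close>
    moreover have "f i = g i" using \<open>f \<in> A\<close> \<open>g \<in> A\<close> by (auto simp: A_def PiE_def extensional_def)
    ultimately show "f = g" by (metis ext)
  qed
  moreover have "F ` A \<subseteq> compositions n"
  proof (rule image_subsetI)
    fix f assume f: "f \<in> A"
    have "(\<Sum>j\<in>UNIV - {i}. f j) \<le> (\<Sum>j\<in>UNIV - {i}. q)" using f by (intro sum_mono) (auto simp: A_def)
    also have "\<dots> \<le> CARD('d) * q" by (simp add: card_Diff_singleton)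
    also have "\<dots> \<le> n" by (simp add: q_def)
    finally have le: "(\<Sum>j\<in>UNIV - {i}. f j) \<le> n" .
    have "(\<Sum>j\<in>UNIV. F f j) = F f i + (\<Sum>j\<in>UNIV - {i}. F f j)"
      by (rule sum.remove) auto
    also have "(\<Sum>j\<in>UNIV - {i}. F f j) = (\<Sum>j\<in>UNIV - {i}. f j)"
      by (intro sum.cong) (auto simp: F_def)
    also have "F f i = n - (\<Sum>j\<in>UNIV - {i}. f j)" by (simp add: F_def)
    finally show "F f \<in> compositions n" using le by (simp add: compositions_def)
  qed
  ultimately show ?thesis
    using card_inj_on_le[OF _ _ finite_compositions, of F A n] by (simp add: q_def)
qed

text \<open>For \<open>x > 0\<close> the nonzero terms form a geometric series with ratio 1/2 and
  first term at most 1. For \<open>x \<ge> 0\<close> the subtracted minimum bounds the terms from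
  \<open>t = n\<close> on; it is what makes the induction close.\<close>

lemma sum_dyadic_le_2:
  fixes x :: real
  shows "(\<Sum>t<n. of_bool (x \<le> 2 ^ t) * (x / 2 ^ t)) \<le> 2 - min 2 (2 * x / 2 ^ n)"
proof (induction n)
  case 0
  show ?case by simp
next
  case (Suc n)
  define y where "y = x / 2 ^ n"
  define S where "S = (\<Sum>t<n. of_bool (x \<le> 2 ^ t) * (x / 2 ^ t))"
  have "S \<le> 2 - min 2 (2 * y)" using Suc by (simp add: S_def y_def)
  moreover have "x \<le> 2 ^ n \<longleftrightarrow> y \<le> 1" by (simp add: y_def)
  ultimately have "S + of_bool (x \<le> 2 ^ n) * y \<le> 2 - min 2 y"
    by (cases "y \<le> 1") (auto simp: min_def split: if_splits)
  then show ?case by (simp add: S_def y_def)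
qed

text \<open>Dividing by the right-hand side, each summand becomes a product over the coordinates, so the sum over
  the compositions of \<open>n\<close> is at most a product of geometric series.\<close>

lemma sum_compositions_freq_box_le:
  fixes k :: "'d::finite \<Rightarrow> int"
  assumes "r \<ge> 1"
  shows "(\<Sum>s\<in>compositions n. of_bool (k \<in> freq_box s)) * (\<Prod>j\<in>UNIV. max 1 \<bar>real_of_int (k j)\<bar>) ^ (2 * r)
    \<le> 2 ^ CARD('d) * (2 ^ n) ^ (2 * r)"
proof -
  define x where "x j = max 1 \<bar>real_of_int (k j)\<bar>" for j
  define g where "g j t = of_bool (x j \<le> 2 ^ t) * (x j / 2 ^ t)" for j and t :: nat
  have x1: "x j \<ge> 1" for j by (simp add: x_def)
  then have x0: "x j \<ge> 0" for j by (rule order_trans[OF zero_le_one])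
  have g0: "g j t \<ge> 0" for j t using x1[of j] by (simp add: g_def)
  have summand: "of_bool (k \<in> freq_box s) * (\<Prod>j\<in>UNIV. x j) ^ (2 * r) \<le> (2 ^ n) ^ (2 * r) * (\<Prod>j\<in>UNIV. g j (s j))"
    if s: "s \<in> compositions n" for s
  proof (cases "k \<in> freq_box s")
    case True
    have le: "x j \<le> 2 ^ s j" for j
    proof -
      have "\<bar>k j\<bar> < 2 ^ s j" using True by (simp add: freq_box_def)
      then have "of_int \<bar>k j\<bar> \<le> (of_int (2 ^ s j) :: real)" by (simp only: of_int_le_iff)
      then show ?thesis by (simp add: x_def)
    qed
    have "(\<Prod>j\<in>UNIV. x j) = (\<Prod>j\<in>UNIV. 2 ^ s j) * (\<Prod>j\<in>UNIV. x j / 2 ^ s j)"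
      by (simp add: prod_dividef)
    also have "(\<Prod>j\<in>UNIV. 2 ^ s j) = (2 :: real) ^ n"
      using s by (simp add: compositions_def power_sum[symmetric])
    finally have "(\<Prod>j\<in>UNIV. x j) ^ (2 * r) = (2 ^ n) ^ (2 * r) * (\<Prod>j\<in>UNIV. x j / 2 ^ s j) ^ (2 * r)"
      by (simp only: power_mult_distrib)
    \<comment> \<open>The product lies between 0 and 1, so the exponent can be lowered to 1.\<close>
    also have "(\<Prod>j\<in>UNIV. x j / 2 ^ s j) ^ (2 * r) \<le> (\<Prod>j\<in>UNIV. x j / 2 ^ s j) ^ 1"
    proof (rule power_decreasing)
      show "0 \<le> (\<Prod>j\<in>UNIV. x j / 2 ^ s j)" using x0 by (simp add: prod_nonneg)
      show "(\<Prod>j\<in>UNIV. x j / 2 ^ s j) \<le> 1"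
        using x0 le by (intro prod_le_1) simp
    qed (use assms in auto)
    also have "(\<Prod>j\<in>UNIV. x j / 2 ^ s j) ^ 1 = (\<Prod>j\<in>UNIV. g j (s j))"
      using le by (simp add: g_def)
    finally show ?thesis using True by simp
  next
    case False
    then show ?thesis by (simp add: prod_nonneg g0)
  qed
  have "(\<Sum>s\<in>compositions n. of_bool (k \<in> freq_box s)) * (\<Prod>j\<in>UNIV. x j) ^ (2 * r)
    = (\<Sum>s\<in>compositions n. of_bool (k \<in> freq_box s) * (\<Prod>j\<in>UNIV. x j) ^ (2 * r))"
    by (rule sum_distrib_right)
  also have "\<dots> \<le> (\<Sum>s\<in>compositions n. (2 ^ n) ^ (2 * r) * (\<Prod>j\<in>UNIV. g j (s j)))"
    by (intro sum_mono summand)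
  \<comment> \<open>The constraint on the sum of the \<open>s j\<close> is relaxed to
    \<open>s j \<le> n\<close>, after which the sum factors over the coordinates.\<close>
  also have "\<dots> \<le> (\<Sum>s\<in>PiE UNIV (\<lambda>_. {..n}). (2 ^ n) ^ (2 * r) * (\<Prod>j\<in>UNIV. g j (s j)))"
    by (intro sum_mono2 compositions_subset finite_PiE) (auto intro!: prod_nonneg mult_nonneg_nonneg g0)
  also have "\<dots> = (2 ^ n) ^ (2 * r) * (\<Prod>j\<in>UNIV. \<Sum>t\<le>n. g j t)"
    by (subst prod_sum_PiE) (auto simp: sum_distrib_left)
  also have "(\<Prod>j\<in>UNIV. \<Sum>t\<le>n. g j t) \<le> (\<Prod>j\<in>(UNIV :: 'd set). 2)"
  proof (intro prod_mono conjI)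
    fix j
    have "(\<Sum>t\<le>n. g j t) \<le> 2 - min 2 (2 * x j / 2 ^ Suc n)"
      using sum_dyadic_le_2[of "x j" "Suc n"] by (simp only: g_def lessThan_Suc_atMost)
    moreover have "min 2 (2 * x j / 2 ^ Suc n) \<ge> 0" using x1[of j] by simp
    ultimately show "(\<Sum>t\<le>n. g j t) \<le> 2" by linarith
  qed (simp add: sum_nonneg g0)
  finally show ?thesis by (simp add: x_def mult.commute)
qed

section \<open>Fourier transforms of hat functions\<close>

lemma Basis_vec_real: "(Basis :: (real^'d) set) = range (\<lambda>j. axis j 1)"
  by (auto simp: Basis_vec_def)

lemma borel_measurable_vec_lambda:
  "(\<lambda>f. \<chi> j. f j) \<in> (\<Pi>\<^sub>M j\<in>(UNIV :: 'd::finite set). (lborel :: real measure)) \<rightarrow>\<^sub>M borel"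
proof (subst borel_measurable_euclidean_space, rule ballI)
  fix b :: "real^'d" assume "b \<in> Basis"
  then obtain j where b: "b = axis j 1" by (auto simp: Basis_vec_real)
  have "(\<lambda>f. f j) \<in> (\<Pi>\<^sub>M j\<in>(UNIV :: 'd set). (lborel :: real measure)) \<rightarrow>\<^sub>M lborel"
    by (rule measurable_component_singleton) simp
  then show "(\<lambda>f. (\<chi> j. f j) \<bullet> b) \<in> borel_measurable (\<Pi>\<^sub>M j\<in>(UNIV :: 'd set). (lborel :: real measure))"
    by (simp add: b inner_axis)
qed

text \<open>Both measures agree on boxes. This carries the Fubini theorem for finite products of
  measures over to \<open>real^'d\<close>.\<close>

lemma lborel_vec_eq_distr:
  "(lborel :: (real^'d) measure) = distr (\<Pi>\<^sub>M j\<in>UNIV. lborel) borel (\<lambda>f. \<chi> j. f j)"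
proof (rule lborel_eqI)
  interpret product_sigma_finite "\<lambda>_ :: 'd. lborel :: real measure" ..
  fix l u :: "real^'d" assume le: "\<And>b. b \<in> Basis \<Longrightarrow> l \<bullet> b \<le> u \<bullet> b"
  have le': "l $ j \<le> u $ j" for j using le[of "axis j 1"] by (simp add: Basis_vec_real inner_axis)
  have "(\<lambda>f. \<chi> j. f j) -` box l u \<inter> space (\<Pi>\<^sub>M j\<in>(UNIV :: 'd set). (lborel :: real measure))
    = PiE UNIV (\<lambda>j. {l $ j<..<u $ j})"
    by (auto simp: mem_box_cart space_PiM PiE_iff)
  then have "emeasure (distr (\<Pi>\<^sub>M j\<in>UNIV. lborel) borel (\<lambda>f. \<chi> j. f j)) (box l u)
    = emeasure (\<Pi>\<^sub>M j\<in>(UNIV :: 'd set). (lborel :: real measure)) (PiE UNIV (\<lambda>j. {l $ j<..<u $ j}))"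
    by (simp add: emeasure_distr borel_measurable_vec_lambda)
  also have "\<dots> = (\<Prod>j\<in>UNIV. emeasure lborel {l $ j<..<u $ j})"
    by (rule emeasure_PiM) auto
  also have "\<dots> = ennreal (\<Prod>j\<in>UNIV. u $ j - l $ j)"
    using le' by (simp add: prod_ennreal)
  also have "(\<Prod>j\<in>UNIV. u $ j - l $ j) = (\<Prod>b\<in>Basis. (u - l) \<bullet> b)"
    unfolding Basis_vec_real by (subst prod.reindex) (auto simp: inj_on_def axis_eq_axis inner_axis)
  finally show "emeasure (distr (\<Pi>\<^sub>M j\<in>UNIV. lborel) borel (\<lambda>f. \<chi> j. f j)) (box l u)
    = ennreal (\<Prod>b\<in>Basis. (u - l) \<bullet> b)" .
qed simp

lemma
  fixes f :: "'d::finite \<Rightarrow> real \<Rightarrow> 'b::{real_normed_field,banach,second_countable_topology}"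
  assumes f: "\<And>j. integrable lborel (f j)"
  shows integrable_prod_vec: "integrable lborel (\<lambda>x :: real^'d. \<Prod>j\<in>UNIV. f j (x $ j))"
    and integral_prod_vec: "(LINT x|lborel. (\<Prod>j\<in>UNIV. f j ((x :: real^'d) $ j))) = (\<Prod>j\<in>UNIV. LINT t|lborel. f j t)"
proof -
  interpret product_sigma_finite "\<lambda>_ :: 'd. lborel :: real measure" ..
  have [measurable]: "f j \<in> borel_measurable borel" for j
    using borel_measurable_integrable[OF f[of j]] by simp
  have meas: "(\<lambda>x :: real^'d. \<Prod>j\<in>UNIV. f j (x $ j)) \<in> borel_measurable borel"
    by measurable
  show "integrable lborel (\<lambda>x :: real^'d. \<Prod>j\<in>UNIV. f j (x $ j))"
    unfolding lborel_vec_eq_distr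
    by (subst integrable_distr_eq[OF borel_measurable_vec_lambda meas])
      (use product_integrable_prod[of UNIV f] f in simp)
  show "(LINT x|lborel. (\<Prod>j\<in>UNIV. f j ((x :: real^'d) $ j))) = (\<Prod>j\<in>UNIV. LINT t|lborel. f j t)"
    unfolding lborel_vec_eq_distr
    by (subst integral_distr[OF borel_measurable_vec_lambda meas])
      (use product_integral_prod[of UNIV f] f in simp)
qed

text \<open>Fubini together with translation invariance. The functions are complex so that the
  exponentials of a Fourier transform can be absorbed into \<open>F\<close> and
  \<open>G\<close>.\<close>

lemma integral_convolution:
  fixes F G :: "real \<Rightarrow> complex"
  assumes F: "integrable lborel F" and G: "integrable lborel G"
  shows "(LINT x|lborel. LINT y|lborel. F (x - y) * G y) = (LINT x|lborel. F x) * (LINT y|lborel. G y)"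
proof -
  have [measurable]: "F \<in> borel_measurable borel" "G \<in> borel_measurable borel"
    using F G by (auto dest: borel_measurable_integrable)
  have shift: "integrable lborel (\<lambda>x. F (x - y))" "(LINT x|lborel. F (x - y)) = (LINT x|lborel. F x)"
    "(LINT x|lborel. norm (F (x - y))) = (LINT x|lborel. norm (F x))" for y
    using lborel_integrable_real_affine[OF F, of 1 "- y"]
      lborel_integral_real_affine[of 1 F "- y"] lborel_integral_real_affine[of 1 "\<lambda>x. norm (F x)" "- y"]
    by (simp_all add: add.commute)
  \<comment> \<open>With \<open>y\<close> as first component the inner integral runs over
    \<open>x\<close>, where the translate of \<open>F\<close> has the same \<open>L\<^sub>1\<close>
    norm for every \<open>y\<close>.\<close>
  have "integrable (lborel \<Otimes>\<^sub>M lborel) (\<lambda>(y, x). F (x - y) * G y)"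
  proof (rule lborel_pair.Fubini_integrable)
    have "integrable lborel (\<lambda>y. norm (G y) * (LINT x|lborel. norm (F x)))"
      using G by (intro integrable_mult_left integrable_norm)
    then show "integrable lborel (\<lambda>y. LINT x|lborel. norm (case (y, x) of (y, x) \<Rightarrow> F (x - y) * G y))"
      by (simp add: norm_mult shift mult.commute)
    show "AE y in lborel. integrable lborel (\<lambda>x. case (y, x) of (y, x) \<Rightarrow> F (x - y) * G y)"
      using shift by simp
  qed measurable
  then have "(LINT x|lborel. LINT y|lborel. F (x - y) * G y) = (LINT y|lborel. LINT x|lborel. F (x - y) * G y)"
    by (rule lborel_pair.Fubini_integral)
  then show ?thesis by (simp add: shift)
qed

text \<open>The Fourier transform of the interval indicator \<open>hat1\<close> at an integer
  frequency, a sinc function. It is real since the interval is symmetric up to an endpoint; the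
  value at \<open>k = 0\<close> is the length of the interval.\<close>

definition hat_ft :: "real \<Rightarrow> int \<Rightarrow> real" where
  "hat_ft u k = (if k = 0 then u else sin (pi * of_int k * u) / (pi * of_int k))"

text \<open>Measurability must be joint in \<open>x\<close> and \<open>u\<close>: the induction
  treats the convolution as an integral with parameters, and later \<open>u\<close> is integrated
  over as well.\<close>

lemma measurable_hat [measurable (raw)]:
  assumes [measurable]: "f \<in> borel_measurable M" "g \<in> borel_measurable M"
  shows "(\<lambda>x. hat r (f x) (g x)) \<in> borel_measurable M"
proof -
  have hat1[measurable]: "(\<lambda>(x, u). hat1 x u) \<in> borel_measurable (borel \<Otimes>\<^sub>M borel)"
    unfolding hat1_def indicator_def atLeastLessThan_iff by measurable
  have "(\<lambda>(x, u). hat r x u) \<in> borel_measurable (borel \<Otimes>\<^sub>M borel)"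
  proof (induction r rule: induct_nat_012)
    case (ge2 n)
    note [measurable] = ge2(2)
    have "(\<lambda>p. LINT y|lborel. hat (Suc n) (fst p - y) (snd p) * hat1 y (snd p)) \<in> borel_measurable (borel \<Otimes>\<^sub>M borel)"
      by (rule lborel.borel_measurable_lebesgue_integral) measurable
    then show ?case by (simp add: convolve_def split_def)
  qed (simp_all add: hat1)
  from measurable_compose[OF _ this, of "\<lambda>x. (f x, g x)" M] show ?thesis by simp
qed

lemma hat_nonneg: "0 \<le> hat r x u"
proof (induction r arbitrary: x rule: induct_nat_012)
  case (ge2 n)
  then show ?case by (simp add: convolve_def hat1_def)
qed (auto simp: hat1_def)

text \<open>Each convolution with \<open>hat1\<close> enlarges the support by \<open>u / 2\<close>
  on either side. The strict inequality avoids the half-open endpoints.\<close>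

lemma hat_eq_0:
  assumes "u > 0" "\<bar>x\<bar> > r * u / 2"
  shows "hat r x u = 0"
  using assms(2)
proof (induction r arbitrary: x rule: induct_nat_012)
  case (ge2 n)
  have "hat (Suc n) (x - y) u * hat1 y u = 0" for y
  proof (cases "y \<in> {- u / 2..<u / 2}")
    case True
    then have "\<bar>x - y\<bar> > Suc n * u / 2" using ge2.prems by (simp add: abs_if field_simps split: if_splits)
    then show ?thesis using ge2.IH(2) by simp
  qed (simp add: hat1_def)
  then have "(LINT y|lborel. hat (Suc n) (x - y) u * hat1 y u) = (LINT y :: real|lborel. 0)"
    by (simp only:)
  then show ?case by (simp add: convolve_def)
qed (use assms(1) in \<open>auto simp: hat1_def abs_if split: if_splits\<close>)

lemma hat1_integrable: "u > 0 \<Longrightarrow> integrable lborel (\<lambda>y. hat1 y u)"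
  and hat1_integral: "u > 0 \<Longrightarrow> (LINT y|lborel. hat1 y u) = u"
  by (simp_all add: hat1_def)

text \<open>Convolution with \<open>hat1\<close> multiplies an upper bound by at most its integral
  \<open>u\<close>, which is at most 1.\<close>

lemma hat_le_1:
  assumes "0 < u" "u \<le> 1"
  shows "hat r x u \<le> 1"
proof (induction r arbitrary: x rule: induct_nat_012)
  case (ge2 n)
  have "(LINT y|lborel. hat (Suc n) (x - y) u * hat1 y u) \<le> (LINT y|lborel. hat1 y u)"
  proof (rule integral_mono')
    show "hat (Suc n) (x - y) u * hat1 y u \<le> hat1 y u" for y
      using ge2(2)[of "x - y"] hat_nonneg by (auto simp: hat1_def indicator_def)
  qed (use assms hat1_integrable in \<open>auto simp: hat1_def\<close>)
  then show ?case using assms hat1_integral by (simp add: convolve_def)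
qed (auto simp: hat1_def indicator_def)

lemma integrable_hat:
  assumes "0 < u" "u \<le> 1"
  shows "integrable lborel (\<lambda>x. hat r x u)"
proof (rule Bochner_Integration.integrable_bound)
  show "integrable lborel (indicator {- real r * u..real r * u} :: real \<Rightarrow> real)"
    by (simp add: integrable_indicator_iff emeasure_lborel_Icc_eq)
  show "AE x in lborel. norm (hat r x u) \<le> norm (indicator {- real r * u..real r * u} x :: real)"
  proof (rule AE_I2)
    fix x
    show "norm (hat r x u) \<le> norm (indicator {- real r * u..real r * u} x :: real)"
    proof (cases "\<bar>x\<bar> > r * u / 2")
      case True
      then show ?thesis using hat_eq_0[OF assms(1) True] by simp
    next
      case False
      moreover have "r * u / 2 \<le> r * u" using assms(1) by simp
      ultimately have "x \<in> {- real r * u..real r * u}" by (auto simp: abs_le_iff)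
      then show ?thesis using hat_nonneg hat_le_1[OF assms] by simp
    qed
  qed
qed measurable

lemma integrable_hat_cis:
  assumes "0 < u" "u \<le> 1"
  shows "integrable lborel (\<lambda>x. of_real (hat r x u) * cis (c * x))"
proof (rule Bochner_Integration.integrable_bound[OF integrable_hat[OF assms, of r]])
  show "(\<lambda>x. of_real (hat r x u) * cis (c * x)) \<in> borel_measurable lborel"
    unfolding cis_conv_exp by measurable
qed (simp add: norm_mult)

lemma hat1_fourier:
  assumes u: "u > 0"
  shows "(LINT y|lborel. of_real (hat1 y u) * cis (2 * pi * of_int k * y)) = of_real (hat_ft u k)"
proof -
  define c where "c = 2 * pi * real_of_int k"
  \<comment> \<open>Adding one endpoint gives a closed interval, on which the fundamental theorem of
    calculus applies.\<close>
  have "AE y in lborel. y \<noteq> u / 2" by (rule AE_lborel_singleton)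
  then have "(LINT y|lborel. of_real (hat1 y u) * cis (c * y)) = (LINT y|lborel. indicator {- u / 2..u / 2} y *\<^sub>R cis (c * y))"
    by (intro integral_cong_AE) (auto simp: hat1_def indicator_def cis_conv_exp elim!: eventually_mono)
  also have "\<dots> = of_real (hat_ft u k)"
  proof (cases "k = 0")
    case True
    then show ?thesis using u by (simp add: c_def hat_ft_def scaleR_conv_of_real)
  next
    case False
    then have c: "c \<noteq> 0" by (simp add: c_def)
    have "(LINT y|lborel. indicator {- u / 2..u / 2} y *\<^sub>R cis (c * y))
      = cis (c * (u / 2)) / (\<i> * c) - cis (c * (- u / 2)) / (\<i> * c)"
    proof (rule integral_FTC_Icc)
      fix x
      have "((\<lambda>x. exp (\<i> * of_real (c * x)) / (\<i> * c)) has_vector_derivative exp (\<i> * of_real (c * x))) (at x within {- u / 2..u / 2})"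
        using c by (auto intro!: derivative_eq_intros has_vector_derivative_real_field simp: field_simps)
      then show "((\<lambda>x. cis (c * x) / (\<i> * c)) has_vector_derivative cis (c * x)) (at x within {- u / 2..u / 2})"
        by (simp add: cis_conv_exp)
    qed (use u in \<open>auto intro!: continuous_intros simp: cis_conv_exp\<close>)
    also have "\<dots> = of_real (2 * sin (c * u / 2) / c)"
      using c by (simp add: complex_eq_iff Re_divide Im_divide power2_eq_square field_simps)
    also have "2 * sin (c * u / 2) / c = hat_ft u k" using False by (simp add: hat_ft_def c_def field_simps)
    finally show ?thesis .
  qed
  finally show ?thesis by (simp add: c_def)
qed

text \<open>The convolution theorem, iterated: the exponential at \<open>x\<close> splits into those
  at \<open>x - y\<close> and \<open>y\<close>, so each convolution contributes one more factor
  \<open>hat_ft u k\<close>.\<close>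

lemma hat_fourier:
  assumes "0 < u" "u \<le> 1" "r \<ge> 1"
  shows "(LINT x|lborel. of_real (hat r x u) * cis (2 * pi * of_int k * x)) = of_real (hat_ft u k ^ r)"
  using assms(3)
proof (induction r rule: induct_nat_012)
  case 1
  then show ?case using hat1_fourier[OF assms(1)] by simp
next
  case (ge2 n)
  define c where "c = 2 * pi * real_of_int k"
  have eq: "of_real (hat (Suc (Suc n)) x u) * cis (c * x)
    = (LINT y|lborel. (of_real (hat (Suc n) (x - y) u) * cis (c * (x - y))) * (of_real (hat1 y u) * cis (c * y)))" for x
  proof -
    have "of_real (hat (Suc (Suc n)) x u) * cis (c * x) = (LINT y|lborel. of_real (hat (Suc n) (x - y) u * hat1 y u)) * cis (c * x)"
      by (simp add: convolve_def del: of_real_mult)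
    also have "\<dots> = (LINT y|lborel. of_real (hat (Suc n) (x - y) u * hat1 y u) * cis (c * x))"
      by simp
    also have "\<dots> = (LINT y|lborel. (of_real (hat (Suc n) (x - y) u) * cis (c * (x - y))) * (of_real (hat1 y u) * cis (c * y)))"
    proof (rule Bochner_Integration.integral_cong[OF refl])
      fix y
      have "cis (c * x) = cis (c * (x - y)) * cis (c * y)" by (simp add: cis_mult algebra_simps)
      then show "of_real (hat (Suc n) (x - y) u * hat1 y u) * cis (c * x)
        = (of_real (hat (Suc n) (x - y) u) * cis (c * (x - y))) * (of_real (hat1 y u) * cis (c * y))"
        by simp
    qed
    finally show ?thesis .
  qed
  have "(LINT x|lborel. of_real (hat (Suc (Suc n)) x u) * cis (c * x))
    = (LINT x|lborel. of_real (hat (Suc n) x u) * cis (c * x)) * (LINT y|lborel. of_real (hat1 y u) * cis (c * y))"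
    unfolding eq
    using integral_convolution[OF integrable_hat_cis[OF assms(1,2), of "Suc n" c] integrable_hat_cis[OF assms(1,2), of 1 c]]
    by simp
  also have "\<dots> = of_real (hat_ft u k ^ Suc (Suc n))"
    using ge2(2) hat1_fourier[OF assms(1), of k] unfolding c_def by simp
  finally show ?case by (simp add: c_def)
qed simp

section \<open>Bessel's inequality and periodization\<close>

text \<open>The integral of the squared modulus of \<open>g\<close> minus its partial expansion is
  nonnegative. As the coefficients pair \<open>g\<close> with \<open>e k\<close> itself, the
  expansion uses the conjugates of the \<open>e k\<close>. Boundedness on a finite measure space
  gives integrability of all terms.\<close>

lemma bessel_inequality:
  fixes g :: "'a \<Rightarrow> real" and e :: "'k \<Rightarrow> 'a \<Rightarrow> complex"
  assumes "finite_measure M" "finite F"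
    and [measurable]: "g \<in> borel_measurable M" "\<And>k. e k \<in> borel_measurable M"
    and bounded: "\<And>x. x \<in> space M \<Longrightarrow> \<bar>g x\<bar> \<le> B" "\<And>k x. norm (e k x) \<le> 1"
    and orth: "\<And>k l. (LINT x|M. e k x * cnj (e l x)) = of_bool (k = l)"
  shows "(\<Sum>k\<in>F. (norm (LINT x|M. of_real (g x) * e k x))\<^sup>2) \<le> (LINT x|M. (g x)\<^sup>2)"
proof -
  interpret finite_measure M by fact
  have cnj [measurable]: "cnj \<in> borel_measurable borel"
    by (intro borel_measurable_continuous_onI continuous_intros)
  have [measurable]: "(\<lambda>x. cnj (e k x)) \<in> borel_measurable M" for k
    by (rule measurable_compose[OF _ cnj]) measurable
  define c where "c k = (LINT x|M. of_real (g x) * e k x)" for k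
  have int_gg: "integrable M (\<lambda>x. complex_of_real (g x) * of_real (g x))"
  proof (rule integrable_const_bound[where B = "B * B"])
    show "AE x in M. norm (complex_of_real (g x) * of_real (g x)) \<le> B * B"
      unfolding norm_mult norm_of_real
      by (intro AE_I2 mult_mono bounded(1) abs_ge_zero order_trans[OF abs_ge_zero bounded(1)])
  qed measurable
  have int_ge: "integrable M (\<lambda>x. of_real (g x) * e k x)" for k
  proof (rule integrable_const_bound[where B = "B * 1"])
    show "AE x in M. norm (of_real (g x) * e k x) \<le> B * 1"
      unfolding norm_mult norm_of_real
      by (intro AE_I2 mult_mono bounded norm_ge_zero order_trans[OF abs_ge_zero bounded(1)])
  qed measurable
  have int_gcnj: "integrable M (\<lambda>x. of_real (g x) * cnj (e k x))"
    and gcnj: "(LINT x|M. of_real (g x) * cnj (e k x)) = cnj (c k)" for k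
    using integrable_cnj[OF int_ge[of k]] Bochner_Integration.integral_cnj[of M "\<lambda>x. of_real (g x) * e k x"] by (simp_all add: c_def)
  have int_ee: "integrable M (\<lambda>x. e k x * cnj (e l x))" for k l
  proof (rule integrable_const_bound[where B = "1 * 1"])
    show "AE x in M. norm (e k x * cnj (e l x)) \<le> 1 * 1"
      unfolding norm_mult complex_mod_cnj using bounded(2) by (intro AE_I2 mult_mono) auto
  qed measurable
  define w where "w x = of_real (g x) - (\<Sum>k\<in>F. c k * cnj (e k x))" for x
  have "of_real ((norm (w x))\<^sup>2) = of_real (g x) * of_real (g x) - (\<Sum>k\<in>F. cnj (c k) * (of_real (g x) * e k x))
      - (\<Sum>k\<in>F. c k * (of_real (g x) * cnj (e k x)))
      + (\<Sum>k\<in>F. \<Sum>l\<in>F. cnj (c k) * c l * (e k x * cnj (e l x)))" for x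
  proof -
    have "of_real ((norm (w x))\<^sup>2) = cnj (w x) * w x"
      by (metis complex_norm_square mult.commute)
    also have "cnj (w x) = of_real (g x) - (\<Sum>k\<in>F. cnj (c k) * e k x)"
      by (simp add: w_def)
    also have "\<dots> * w x = of_real (g x) * of_real (g x) - of_real (g x) * (\<Sum>k\<in>F. c k * cnj (e k x))
      - (\<Sum>k\<in>F. cnj (c k) * e k x) * of_real (g x)
      + (\<Sum>k\<in>F. cnj (c k) * e k x) * (\<Sum>k\<in>F. c k * cnj (e k x))"
      by (simp add: w_def algebra_simps)
    finally show ?thesis
      by (simp add: sum_product sum_distrib_left sum_distrib_right mult_ac)
  qed
  then have "(LINT x|M. complex_of_real ((norm (w x))\<^sup>2)) = (LINT x|M. of_real (g x) * of_real (g x))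
      - (\<Sum>k\<in>F. cnj (c k) * c k) - (\<Sum>k\<in>F. c k * cnj (c k))
      + (\<Sum>k\<in>F. \<Sum>l\<in>F. cnj (c k) * c l * of_bool (k = l))"
    using int_gg int_ge int_gcnj int_ee orth by (simp add: gcnj c_def[symmetric])
  also have "(\<Sum>k\<in>F. \<Sum>l\<in>F. cnj (c k) * c l * of_bool (k = l)) = (\<Sum>k\<in>F. \<Sum>l\<in>F. if k = l then cnj (c k) * c l else 0)"
    by (intro sum.cong) auto
  also have "\<dots> = (\<Sum>k\<in>F. cnj (c k) * c k)"
    using assms(2) by simp
  finally have "(LINT x|M. complex_of_real ((norm (w x))\<^sup>2)) = (LINT x|M. of_real ((g x)\<^sup>2)) - (\<Sum>k\<in>F. of_real ((norm (c k))\<^sup>2))"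
    unfolding complex_norm_square by (simp add: power2_eq_square)
  then have "complex_of_real (LINT x|M. (norm (w x))\<^sup>2) = of_real ((LINT x|M. (g x)\<^sup>2) - (\<Sum>k\<in>F. (norm (c k))\<^sup>2))"
    unfolding integral_complex_of_real by simp
  then have "(LINT x|M. (norm (w x))\<^sup>2) = (LINT x|M. (g x)\<^sup>2) - (\<Sum>k\<in>F. (norm (c k))\<^sup>2)"
    by (simp only: of_real_eq_iff)
  moreover have "(LINT x|M. (norm (w x))\<^sup>2) \<ge> 0" by simp
  ultimately show ?thesis by (simp add: c_def)
qed

text \<open>The translates of \<open>{0..<1}\<close> by the integers from \<open>- R\<close> to
  \<open>R\<close> are disjoint and cover the support of \<open>F\<close>.\<close>

lemma integral_sum_int_translates:
  fixes F :: "real \<Rightarrow> 'b::{banach,second_countable_topology}"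
  assumes F: "integrable lborel F" and supp: "\<And>x. \<bar>x\<bar> \<ge> of_int R \<Longrightarrow> F x = 0"
  shows "(LINT x|lborel. indicator {0..<1} x *\<^sub>R (\<Sum>n\<in>{- R..R}. F (of_int n + x))) = (LINT x|lborel. F x)"
proof -
  have int: "integrable lborel (\<lambda>x. indicator {0..<1} x *\<^sub>R F (of_int n + x))" for n
    using lborel_integrable_real_affine[OF F, of 1 "of_int n"] by (intro integrable_mult_indicator) auto
  have int': "integrable lborel (\<lambda>x. indicator {of_int n..<of_int n + 1} x *\<^sub>R F x)" for n :: int
    using F by (intro integrable_mult_indicator) auto
  have "(LINT x|lborel. indicator {0..<1} x *\<^sub>R (\<Sum>n\<in>{- R..R}. F (of_int n + x)))
    = (\<Sum>n\<in>{- R..R}. LINT x|lborel. indicator {0..<1} x *\<^sub>R F (of_int n + x))"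
    unfolding scaleR_sum_right by (rule Bochner_Integration.integral_sum[OF int])
  also have "\<dots> = (\<Sum>n\<in>{- R..R}. LINT x|lborel. indicator {of_int n..<of_int n + 1} x *\<^sub>R F x)"
  proof (rule sum.cong[OF refl])
    fix n :: int
    have "indicator {of_int n..<of_int n + 1} (of_int n + x) = (indicator {0..<1} x :: real)" for x :: real
      by (auto simp: indicator_def)
    then show "(LINT x|lborel. indicator {0..<1} x *\<^sub>R F (of_int n + x))
      = (LINT x|lborel. indicator {of_int n..<of_int n + 1} x *\<^sub>R F x)"
      using lborel_integral_real_affine[of 1 "\<lambda>x. indicator {of_int n..<of_int n + 1} x *\<^sub>R F x" "of_int n"] by simp
  qed
  also have "\<dots> = (LINT x|lborel. (\<Sum>n\<in>{- R..R}. indicator {of_int n..<of_int n + 1} x *\<^sub>R F x))"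
    by (rule Bochner_Integration.integral_sum[OF int', symmetric])
  also have "\<dots> = (LINT x|lborel. F x)"
  proof (rule Bochner_Integration.integral_cong[OF refl])
    fix x
    show "(\<Sum>n\<in>{- R..R}. indicator {of_int n..<of_int n + 1} x *\<^sub>R F x) = F x"
    proof (cases "\<bar>x\<bar> \<ge> of_int R")
      case False
      then have fl: "\<lfloor>x\<rfloor> \<in> {- R..R}" by (auto simp: le_floor_iff floor_le_iff)
      have "(\<Sum>n\<in>{- R..R}. indicator {of_int n..<of_int n + 1} x *\<^sub>R F x) = (\<Sum>n\<in>{- R..R}. if \<lfloor>x\<rfloor> = n then F x else 0)"
        by (intro sum.cong) (auto simp: indicator_def floor_eq_iff)
      then show ?thesis using fl by simp
    qed (simp add: supp)
  qed
  finally show ?thesis .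
qed

text \<open>The one-dimensional factor of \<open>periodic_hat\<close>, as a finite sum. For
  \<open>\<bar>t\<bar> < 1\<close> and \<open>0 < u \<le> 1/2\<close> the omitted terms vanish,
  since \<open>hat r\<close> is 0 at distance more than \<open>r\<close> from the origin.\<close>

definition periodized_hat :: "nat \<Rightarrow> real \<Rightarrow> real \<Rightarrow> real" where
  "periodized_hat r t u = (\<Sum>n\<in>{- (int r + 1)..int r + 1}. hat r (of_int n + t) u)"

lemma measurable_periodized_hat [measurable (raw)]:
  assumes [measurable]: "f \<in> borel_measurable M" "g \<in> borel_measurable M"
  shows "(\<lambda>x. periodized_hat r (f x) (g x)) \<in> borel_measurable M"
  unfolding periodized_hat_def by measurable

lemma abs_periodized_hat_le:
  assumes "0 < u" "u \<le> 1"
  shows "\<bar>periodized_hat r t u\<bar> \<le> 2 * real r + 3"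
proof -
  have "\<bar>periodized_hat r t u\<bar> \<le> (\<Sum>n\<in>{- (int r + 1)..int r + 1}. \<bar>hat r (of_int n + t) u\<bar>)"
    unfolding periodized_hat_def by (rule sum_abs)
  also have "\<dots> \<le> (\<Sum>n\<in>{- (int r + 1)..int r + 1}. 1)"
    using hat_nonneg hat_le_1[OF assms] by (intro sum_mono) simp
  finally show ?thesis by simp
qed

lemma hat_eq_0_half:
  assumes "0 < u" "u \<le> 1/2" "\<bar>x\<bar> > real r"
  shows "hat r x u = 0"
proof -
  have "r * u \<le> r * (1/2)" using assms(2) by (intro mult_left_mono) auto
  then have "\<bar>x\<bar> > r * u / 2" using assms(3) by simp
  then show ?thesis by (rule hat_eq_0[OF assms(1)])
qed

text \<open>The exponential has period 1, so integrating the periodization over one period amounts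
  to integrating the hat function over the line. The shift by \<open>x\<close> only produces a
  phase.\<close>

lemma periodized_hat_fourier:
  assumes u: "0 < u" "u \<le> 1/2" and r: "r \<ge> 1" and x: "0 \<le> x" "x < 1"
  shows "(LINT z|lborel. indicator {0..<1} z *\<^sub>R (of_real (periodized_hat r (x - z) u) * cis (- (2 * pi * of_int k * z))))
    = cis (- (2 * pi * of_int k * x)) * of_real (hat_ft u k ^ r)"
proof -
  define c where "c = 2 * pi * real_of_int k"
  define F where "F y = of_real (hat r (x - y) u) * cis (- (c * y))" for y
  have cn: "cis (- (c * of_int n)) = 1" for n
  proof -
    have "cis (2 * pi * of_int (- (k * n))) = 1" by (rule cis_multiple_2pi) simp
    then show ?thesis by (simp add: c_def mult.assoc)
  qed
  have F_eq: "F (x - y) = cis (- (c * x)) * (of_real (hat r y u) * cis (c * y))" for y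
    by (simp add: F_def right_diff_distrib cis_mult algebra_simps)
  have int: "integrable lborel (\<lambda>y. F (x - y))"
    unfolding F_eq using u by (intro integrable_mult_right integrable_hat_cis) auto
  have F_int: "integrable lborel F"
    using lborel_integrable_real_affine_iff[of "-1" F x] int by simp
  have F_sum: "(\<Sum>n\<in>{- (int r + 1)..int r + 1}. F (of_int n + z)) = of_real (periodized_hat r (x - z) u) * cis (- (c * z))" for z
  proof -
    have "F (of_int n + z) = of_real (hat r (of_int (- n) + (x - z)) u) * cis (- (c * z))" for n
    proof -
      have "cis (- (c * (of_int n + z))) = cis (- (c * of_int n)) * cis (- (c * z))"
        by (simp add: cis_mult algebra_simps)
      then show ?thesis by (simp add: F_def cn algebra_simps)
    qed
    then have "(\<Sum>n\<in>{- (int r + 1)..int r + 1}. F (of_int n + z))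
      = (\<Sum>n\<in>{- (int r + 1)..int r + 1}. of_real (hat r (of_int (- n) + (x - z)) u)) * cis (- (c * z))"
      by (simp only: sum_distrib_right)
    \<comment> \<open>Moving \<open>z\<close> by \<open>n\<close> moves \<open>x - z\<close> by
      \<open>- n\<close>; the range of summation is symmetric.\<close>
    also have "(\<Sum>n\<in>{- (int r + 1)..int r + 1}. complex_of_real (hat r (of_int (- n) + (x - z)) u))
      = (\<Sum>n\<in>{- (int r + 1)..int r + 1}. of_real (hat r (of_int n + (x - z)) u))"
      by (rule sum.reindex_bij_witness[of _ uminus uminus]) auto
    finally show ?thesis by (simp add: periodized_hat_def)
  qed
  have "(LINT z|lborel. indicator {0..<1} z *\<^sub>R (\<Sum>n\<in>{- (int r + 1)..int r + 1}. F (of_int n + z))) = (LINT y|lborel. F y)"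
  proof (rule integral_sum_int_translates[OF F_int])
    fix y :: real assume "\<bar>y\<bar> \<ge> of_int (int r + 1)"
    then have "\<bar>x - y\<bar> > real r" using x by simp
    then show "F y = 0" using hat_eq_0_half[OF u] by (simp add: F_def)
  qed
  also have "(LINT y|lborel. F y) = (LINT y|lborel. F (x - y))"
    using lborel_integral_real_affine[of "-1" F x] by simp
  also have "\<dots> = cis (- (c * x)) * of_real (hat_ft u k ^ r)"
    unfolding F_eq using hat_fourier[of u r k] u r by (simp add: c_def)
  finally show ?thesis unfolding F_sum by (simp add: c_def)
qed

lemma periodized_hat_integral:
  assumes u: "0 < u" "u \<le> 1/2" and r: "r \<ge> 1" and z: "0 \<le> z" "z < 1"
  shows "(LINT x|lborel. indicator {0..<1} x * periodized_hat r (x - z) u) = u ^ r"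
proof -
  have int: "integrable lborel (\<lambda>x. hat r (x - z) u)"
    using lborel_integrable_real_affine[OF integrable_hat, of u 1 r "- z"] u by simp
  have "(LINT x|lborel. indicator {0..<1} x *\<^sub>R (\<Sum>n\<in>{- (int r + 1)..int r + 1}. hat r (of_int n + x - z) u))
    = (LINT x|lborel. hat r (x - z) u)"
  proof (rule integral_sum_int_translates[OF int])
    fix y :: real assume "\<bar>y\<bar> \<ge> of_int (int r + 1)"
    then have "\<bar>y - z\<bar> > real r" using z by simp
    then show "hat r (y - z) u = 0" using hat_eq_0_half[OF u] by simp
  qed
  also have "\<dots> = (LINT x|lborel. hat r x u)"
    using lborel_integral_real_affine[of 1 "\<lambda>x. hat r x u" "- z"] by simp
  also have "complex_of_real \<dots> = of_real (u ^ r)"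
    using hat_fourier[of u r 0] u r by (simp add: hat_ft_def)
  then have "(LINT x|lborel. hat r x u) = u ^ r" by (simp only: of_real_eq_iff)
  finally show ?thesis by (simp add: periodized_hat_def add_diff_eq)
qed

section \<open>Fourier coefficients of the cubature error\<close>

definition freq_weight :: "('d::finite \<Rightarrow> int) \<Rightarrow> real" where
  "freq_weight k = (\<Prod>j\<in>UNIV. max 1 \<bar>real_of_int (k j)\<bar>)"

lemma sets_cube:
  assumes [measurable]: "A \<in> sets borel"
  shows "{x :: real^'d. \<forall>j. x $ j \<in> A} \<in> sets borel"
  by measurable

text \<open>The indicator of a cube is the product of the indicators of its sides. A general side
  \<open>A\<close> covers both the unit cube and the half cube.\<close>

lemma
  fixes f :: "'d::finite \<Rightarrow> real \<Rightarrow> 'b::{real_normed_field,banach,second_countable_topology}"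
  assumes A: "A \<in> sets borel" and f: "\<And>j. integrable lborel (\<lambda>t. indicator A t *\<^sub>R f j t)"
  shows integrable_prod_cube:
      "integrable (restrict_space lborel {x :: real^'d. \<forall>j. x $ j \<in> A}) (\<lambda>x. \<Prod>j\<in>UNIV. f j (x $ j))"
    and integral_prod_cube:
      "(LINT x|restrict_space lborel {x :: real^'d. \<forall>j. x $ j \<in> A}. (\<Prod>j\<in>UNIV. f j (x $ j)))
        = (\<Prod>j\<in>UNIV. LINT t|lborel. indicator A t *\<^sub>R f j t)"
proof -
  have eq: "indicator {x. \<forall>j. x $ j \<in> A} x *\<^sub>R (\<Prod>j\<in>UNIV. f j (x $ j))
    = (\<Prod>j\<in>UNIV. indicator A (x $ j) *\<^sub>R f j (x $ j))" for x :: "real^'d"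
  proof (cases "\<forall>j. x $ j \<in> A")
    case False
    then obtain j where "x $ j \<notin> A" by blast
    then have "indicator A (x $ j) *\<^sub>R f j (x $ j) = 0" by simp
    then have "(\<Prod>j\<in>UNIV. indicator A (x $ j) *\<^sub>R f j (x $ j)) = 0"
      by (intro prod_zero) auto
    then show ?thesis using False by simp
  qed simp
  show "integrable (restrict_space lborel {x :: real^'d. \<forall>j. x $ j \<in> A}) (\<lambda>x. \<Prod>j\<in>UNIV. f j (x $ j))"
    using integrable_prod_vec[of "\<lambda>j t. indicator A t *\<^sub>R f j t"] sets_cube[OF A] f
    by (subst integrable_restrict_space) (simp_all add: eq)
  show "(LINT x|restrict_space lborel {x :: real^'d. \<forall>j. x $ j \<in> A}. (\<Prod>j\<in>UNIV. f j (x $ j)))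
        = (\<Prod>j\<in>UNIV. LINT t|lborel. indicator A t *\<^sub>R f j t)"
    using integral_prod_vec[of "\<lambda>j t. indicator A t *\<^sub>R f j t"] sets_cube[OF A] f
    by (subst integral_restrict_space) (simp_all add: eq)
qed

lemma unit_cube_eq: "unit_cube = {x :: real^'d. \<forall>j. x $ j \<in> {0..<1}}"
  by (auto simp: unit_cube_def)

lemma half_cube_eq: "half_cube = {x :: real^'d. \<forall>j. x $ j \<in> {0<..1/2}}"
  by (auto simp: half_cube_def)

lemma sets_unit_cube [measurable]: "(unit_cube :: (real^'d) set) \<in> sets borel"
  and sets_half_cube [measurable]: "(half_cube :: (real^'d) set) \<in> sets borel"
  unfolding unit_cube_eq half_cube_eq by (simp_all add: sets_cube)

lemma finite_measure_restrict_lborel: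
  assumes "S \<in> sets borel" "bounded S"
  shows "finite_measure (restrict_space lborel S)"
proof (rule finite_measureI)
  show "emeasure (restrict_space lborel S) (space (restrict_space lborel S)) \<noteq> \<infinity>"
    using assms emeasure_bounded_finite[OF assms(2)] by (simp add: emeasure_restrict_space space_restrict_space)
qed

lemma finite_measure_unit_cube: "finite_measure (restrict_space lborel (unit_cube :: (real^'d) set))"
  and finite_measure_half_cube: "finite_measure (restrict_space lborel (half_cube :: (real^'d) set))"
proof -
  have "x $ j \<in> {0..1}" if "x \<in> unit_cube \<union> half_cube" for x :: "real^'d" and j
  proof -
    have "0 \<le> x $ j \<and> x $ j < 1 \<or> 0 < x $ j \<and> x $ j \<le> 1/2"
      using that by (auto simp: unit_cube_def half_cube_def)
    then show ?thesis by auto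
  qed
  then have "unit_cube \<subseteq> cbox (\<chi> j. 0) (\<chi> j. 1 :: real^'d)" "half_cube \<subseteq> cbox (\<chi> j. 0) (\<chi> j. 1 :: real^'d)"
    by (auto simp: mem_box_cart)
  then have "bounded (unit_cube :: (real^'d) set)" "bounded (half_cube :: (real^'d) set)"
    by (auto intro: bounded_subset[OF bounded_cbox])
  then show "finite_measure (restrict_space lborel (unit_cube :: (real^'d) set))"
    "finite_measure (restrict_space lborel (half_cube :: (real^'d) set))"
    by (auto intro!: finite_measure_restrict_lborel)
qed

text \<open>Only finitely many integer vectors contribute, and they form a grid; by distributivity
  the sum of products over the grid is a product of sums.\<close>

lemma periodic_hat_eq:
  fixes x z u :: "real^'d"
  assumes "x \<in> unit_cube" "z \<in> unit_cube" "u \<in> half_cube"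
  shows "periodic_hat r x z u = (\<Prod>j\<in>UNIV. periodized_hat r (x $ j - z $ j) (u $ j))"
proof -
  define A where "A = {- (int r + 1)..int r + 1}"
  define P where "P = PiE (UNIV :: 'd set) (\<lambda>_. A)"
  define f where "f n = hat_prod r ((\<chi> j. of_int (n $ j)) + x) z u" for n :: "int^'d"
  have fin: "finite P" by (simp add: P_def A_def finite_PiE)
  have f_eq: "f n = (\<Prod>j\<in>UNIV. hat r (of_int (n $ j) + (x $ j - z $ j)) (u $ j))" for n
    by (simp add: f_def hat_prod_def add_diff_eq)
  have zero: "f n = 0" if "n \<notin> (\<lambda>g. \<chi> j. g j) ` P" for n
  proof -
    have "(\<lambda>j. n $ j) \<notin> P" using that by (metis image_eqI vec_nth_inverse vec_lambda_unique)
    then obtain j where "n $ j \<notin> A" by (auto simp: P_def)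
    then have "\<bar>n $ j\<bar> > int r + 1" by (auto simp: A_def)
    then have "real_of_int \<bar>n $ j\<bar> > real_of_int (int r + 1)" by (simp only: of_int_less_iff)
    then have "\<bar>of_int (n $ j)\<bar> > real r + 1" by simp
    moreover have "\<bar>x $ j - z $ j\<bar> < 1" using assms(1,2)[unfolded unit_cube_def] by (auto simp: abs_less_iff) (smt (verit))+
    ultimately have "\<bar>of_int (n $ j) + (x $ j - z $ j)\<bar> > real r" by linarith
    then have "hat r (of_int (n $ j) + (x $ j - z $ j)) (u $ j) = 0"
      using assms(3) by (intro hat_eq_0_half) (auto simp: half_cube_def)
    then show ?thesis unfolding f_eq by (intro prod_zero) auto
  qed
  have "periodic_hat r x z u = (\<Sum>\<^sub>\<infinity>n\<in>UNIV. f n)" by (simp add: periodic_hat_def f_def)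
  also have "\<dots> = (\<Sum>\<^sub>\<infinity>n\<in>(\<lambda>g. \<chi> j. g j) ` P. f n)"
    by (rule infsum_cong_neutral) (auto simp: zero)
  also have "\<dots> = (\<Sum>n\<in>(\<lambda>g. \<chi> j. g j) ` P. f n)"
    by (rule infsum_finite) (simp add: fin)
  also have "\<dots> = (\<Sum>g\<in>P. f (\<chi> j. g j))"
  proof (subst sum.reindex)
    show "inj_on (\<lambda>g. \<chi> j. g j) P" by (auto simp: inj_on_def vec_eq_iff fun_eq_iff)
  qed simp
  also have "\<dots> = (\<Prod>j\<in>UNIV. \<Sum>n\<in>A. hat r (of_int n + (x $ j - z $ j)) (u $ j))"
    unfolding P_def by (subst prod_sum_PiE) (auto simp: A_def f_eq)
  finally show ?thesis by (simp add: periodized_hat_def A_def)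
qed

text \<open>The cubature error with its integral evaluated and the periodization factored. It is a
  finite expression in \<open>z\<close> and \<open>u\<close>, hence jointly measurable, and agrees
  with \<open>cubature_error\<close> on the cubes.\<close>

definition product_error ::
  "nat \<Rightarrow> nat \<Rightarrow> (nat \<Rightarrow> real^'d) \<Rightarrow> (nat \<Rightarrow> real) \<Rightarrow> real^'d \<Rightarrow> real^'d \<Rightarrow> real" where
  "product_error r m \<xi> w z u = (\<Prod>j\<in>UNIV. (u $ j) ^ r)
    - (\<Sum>\<mu>=1..m. w \<mu> * (\<Prod>j\<in>UNIV. periodized_hat r (\<xi> \<mu> $ j - z $ j) (u $ j)))"

lemma integrable_indicator_bounded:
  fixes f :: "real \<Rightarrow> 'b::{banach,second_countable_topology}"
  assumes A: "A \<in> sets borel" "bounded A" and f: "f \<in> borel_measurable borel" "\<And>t. t \<in> A \<Longrightarrow> norm (f t) \<le> B"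
  shows "integrable lborel (\<lambda>t. indicator A t *\<^sub>R f t)"
  using assms emeasure_bounded_finite[OF A(2)]
  by (intro integrableI_bounded_set_indicator[where B = B]) auto

lemma integrable_periodized_hat:
  assumes "0 < u" "u \<le> 1/2"
  shows "integrable lborel (\<lambda>t. indicator {0..<1} t *\<^sub>R periodized_hat r (t - z) u)"
proof (rule integrable_indicator_bounded)
  show "norm (periodized_hat r (t - z) u) \<le> 2 * real r + 3" for t
    using abs_periodized_hat_le[of u r "t - z"] assms by simp
qed simp_all

lemma cubature_error_eq:
  fixes z u :: "real^'d"
  assumes z: "z \<in> unit_cube" and u: "u \<in> half_cube" and \<xi>: "\<forall>\<mu>\<in>{1..m}. \<xi> \<mu> \<in> unit_cube" and r: "r \<ge> 1"
  shows "cubature_error r m \<xi> w z u = product_error r m \<xi> w z u"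
proof -
  have zj: "0 \<le> z $ j" "z $ j < 1" and uj: "0 < u $ j" "u $ j \<le> 1/2" for j
    using z u by (auto simp: unit_cube_def half_cube_def)
  have "(LINT x:unit_cube|lborel. periodic_hat r x z u)
    = (LINT x:unit_cube|lborel. (\<Prod>j\<in>UNIV. periodized_hat r (x $ j - z $ j) (u $ j)))"
    using z u by (intro set_lebesgue_integral_cong) (auto simp: periodic_hat_eq)
  also have "\<dots> = (LINT x|restrict_space lborel unit_cube. (\<Prod>j\<in>UNIV. periodized_hat r (x $ j - z $ j) (u $ j)))"
    unfolding set_lebesgue_integral_def by (subst integral_restrict_space) auto
  also have "\<dots> = (\<Prod>j\<in>UNIV. LINT t|lborel. indicator {0..<1} t *\<^sub>R periodized_hat r (t - z $ j) (u $ j))"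
    unfolding unit_cube_eq using integrable_periodized_hat[OF uj]
    by (subst integral_prod_cube[where f = "\<lambda>j t. periodized_hat r (t - z $ j) (u $ j)"]) auto
  also have "\<dots> = (\<Prod>j\<in>UNIV. (u $ j) ^ r)"
    using periodized_hat_integral[OF uj r zj] by simp
  finally have "(LINT x:unit_cube|lborel. periodic_hat r x z u) = (\<Prod>j\<in>UNIV. (u $ j) ^ r)" .
  moreover have "(\<Sum>\<mu>=1..m. w \<mu> * periodic_hat r (\<xi> \<mu>) z u)
    = (\<Sum>\<mu>=1..m. w \<mu> * (\<Prod>j\<in>UNIV. periodized_hat r (\<xi> \<mu> $ j - z $ j) (u $ j)))"
    using \<xi> z u by (intro sum.cong refl arg_cong2[where f = "(*)"] periodic_hat_eq) auto
  ultimately show ?thesis by (simp add: cubature_error_def product_error_def)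
qed

text \<open>A crude bound that depends on the weights. It serves integrability only and does not
  enter the final constant.\<close>

lemma abs_product_error_le:
  assumes u: "u \<in> half_cube"
  shows "\<bar>product_error r m \<xi> w z (u :: real^'d)\<bar> \<le> 1 + (\<Sum>\<mu>=1..m. \<bar>w \<mu>\<bar>) * (2 * real r + 3) ^ CARD('d)"
proof -
  have uj: "0 < u $ j" "u $ j \<le> 1" for j using u[unfolded half_cube_def] by (auto intro: order_trans[of _ "1/2"])
  have "\<bar>\<Prod>j\<in>UNIV. (u $ j) ^ r\<bar> \<le> 1"
    unfolding abs_prod using uj by (intro prod_le_1) (auto simp: power_le_one less_imp_le)
  moreover have "\<bar>\<Sum>\<mu>=1..m. w \<mu> * (\<Prod>j\<in>UNIV. periodized_hat r (\<xi> \<mu> $ j - z $ j) (u $ j))\<bar>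
    \<le> (\<Sum>\<mu>=1..m. \<bar>w \<mu>\<bar> * (2 * real r + 3) ^ CARD('d))"
  proof (rule order_trans[OF sum_abs], rule sum_mono)
    fix \<mu>
    have "(\<Prod>j\<in>UNIV. \<bar>periodized_hat r (\<xi> \<mu> $ j - z $ j) (u $ j)\<bar>) \<le> (\<Prod>j\<in>(UNIV :: 'd set). 2 * real r + 3)"
      using abs_periodized_hat_le[OF uj] by (intro prod_mono) auto
    then show "\<bar>w \<mu> * (\<Prod>j\<in>UNIV. periodized_hat r (\<xi> \<mu> $ j - z $ j) (u $ j))\<bar> \<le> \<bar>w \<mu>\<bar> * (2 * real r + 3) ^ CARD('d)"
      by (simp add: abs_mult abs_prod mult_left_mono)
  qed
  ultimately show ?thesis by (simp add: product_error_def sum_distrib_right)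
qed

lemma measurable_product_error:
  assumes [measurable]: "\<And>j. (\<lambda>x. f x $ j) \<in> borel_measurable M" "\<And>j. (\<lambda>x. g x $ j) \<in> borel_measurable M"
  shows "(\<lambda>x. product_error r m \<xi> w (f x) (g x)) \<in> borel_measurable M"
  unfolding product_error_def by measurable

text \<open>The Fourier coefficients of the signed measure \<open>dx - (\<Sum>\<mu>. w \<mu> \<delta>\<^bsub>\<xi> \<mu>\<^esub>)\<close> on the torus.\<close>

definition exp_sum_error :: "nat \<Rightarrow> (nat \<Rightarrow> real^'d) \<Rightarrow> (nat \<Rightarrow> real) \<Rightarrow> ('d \<Rightarrow> int) \<Rightarrow> complex" where
  "exp_sum_error m \<xi> w k = of_bool (k = (\<lambda>_. 0))
    - (\<Sum>\<mu>=1..m. of_real (w \<mu>) * (\<Prod>j\<in>UNIV. cis (- (2 * pi * of_int (k j) * \<xi> \<mu> $ j))))"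

text \<open>A shift by 1/2 turns the integral into the Fourier transform of \<open>hat1\<close> with
  \<open>u = 1\<close>, which vanishes at nonzero integers.\<close>

lemma integral_cis_period:
  "(LINT t|lborel. indicator {0..<1} t *\<^sub>R cis (- (2 * pi * of_int k * t))) = of_bool (k = 0)"
proof -
  have "(LINT t|lborel. indicator {0..<1} t *\<^sub>R cis (- (2 * pi * of_int k * t)))
    = (LINT t|lborel. indicator {0..<1} (1/2 + t :: real) *\<^sub>R cis (- (2 * pi * of_int k * (1/2 + t))))"
    by (subst lborel_integral_real_affine[of 1 _ "1/2"]) simp_all
  also have "\<dots> = (LINT t|lborel. cis (- (pi * of_int k)) * (of_real (hat1 t 1) * cis (2 * pi * of_int (- k) * t)))"
  proof (rule Bochner_Integration.integral_cong[OF refl])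
    fix t
    have "cis (- (2 * pi * of_int k * (1/2 + t))) = cis (- (pi * of_int k)) * cis (2 * pi * of_int (- k) * t)"
      by (simp add: cis_mult algebra_simps)
    then show "indicator {0..<1} (1/2 + t :: real) *\<^sub>R cis (- (2 * pi * of_int k * (1/2 + t)))
      = cis (- (pi * of_int k)) * (of_real (hat1 t 1) * cis (2 * pi * of_int (- k) * t))"
      by (auto simp: hat1_def indicator_def)
  qed
  also have "\<dots> = cis (- (pi * of_int k)) * of_real (hat_ft 1 (- k))"
    using hat1_fourier[of 1 "- k"] by simp
  also have "\<dots> = of_bool (k = 0)"
    by (simp add: hat_ft_def sin_zero_iff_int2 mult.commute)
  finally show ?thesis .
qed

lemma integrable_cis_period: "integrable lborel (\<lambda>t. indicator {0..<1} t *\<^sub>R cis (c * t))"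
  by (rule integrable_indicator_bounded[where B = 1]) (auto simp: cis_conv_exp)

text \<open>The error is a convolution of the signed measure with a product kernel, so its
  coefficients are products. All integrals split into one-dimensional ones: \<open>f\<close> holds
  the factors of the constant term, \<open>g \<mu>\<close> those of the knot
  \<open>\<xi> \<mu>\<close>.\<close>

lemma product_error_fourier:
  fixes u :: "real^'d" and k :: "'d \<Rightarrow> int"
  assumes u: "u \<in> half_cube" and \<xi>: "\<forall>\<mu>\<in>{1..m}. \<xi> \<mu> \<in> unit_cube" and r: "r \<ge> 1"
  shows "(LINT z|restrict_space lborel unit_cube. of_real (product_error r m \<xi> w z u) * (\<Prod>j\<in>UNIV. cis (- (2 * pi * of_int (k j) * z $ j))))
    = of_real (\<Prod>j\<in>UNIV. hat_ft (u $ j) (k j) ^ r) * exp_sum_error m \<xi> w k"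
proof -
  have uj: "0 < u $ j" "u $ j \<le> 1/2" "u $ j \<le> 1" for j
    using u[unfolded half_cube_def] by (auto intro: order_trans[of _ "1/2"])
  have \<xi>j: "0 \<le> \<xi> \<mu> $ j" "\<xi> \<mu> $ j < 1" if "\<mu> \<in> {1..m}" for \<mu> j
    using \<xi> that by (auto simp: unit_cube_def)
  define e where "e j t = cis (- (2 * pi * of_int (k j) * t))" for j t
  have e_meas [measurable]: "e j \<in> borel_measurable borel" for j
    unfolding e_def cis_conv_exp by measurable
  define f where "f j t = complex_of_real ((u $ j) ^ r) * e j t" for j t
  define g where "g \<mu> j t = of_real (periodized_hat r (\<xi> \<mu> $ j - t) (u $ j)) * e j t" for \<mu> j t
  have f_int: "integrable lborel (\<lambda>t. indicator {0..<1} t *\<^sub>R f j t)" for j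
  proof (rule integrable_indicator_bounded)
    show "norm (f j t) \<le> norm ((u $ j) ^ r)" for t by (simp add: f_def e_def norm_mult norm_power power_abs)
    show "f j \<in> borel_measurable borel" unfolding f_def[abs_def] by measurable
  qed auto
  have g_int: "integrable lborel (\<lambda>t. indicator {0..<1} t *\<^sub>R g \<mu> j t)" for \<mu> j
  proof (rule integrable_indicator_bounded[where B = "2 * real r + 3"])
    show "norm (g \<mu> j t) \<le> 2 * real r + 3" for t
      using abs_periodized_hat_le[OF uj(1,3)] by (simp add: g_def e_def norm_mult)
    show "g \<mu> j \<in> borel_measurable borel" unfolding g_def[abs_def] by measurable
  qed auto
  have f_cube: "integrable (restrict_space lborel unit_cube) (\<lambda>z :: real^'d. \<Prod>j\<in>UNIV. f j (z $ j))"
    "(LINT z|restrict_space lborel unit_cube. (\<Prod>j\<in>UNIV. f j ((z :: real^'d) $ j)))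
      = (\<Prod>j\<in>UNIV. LINT t|lborel. indicator {0..<1} t *\<^sub>R f j t)"
    unfolding unit_cube_eq
    by (rule integrable_prod_cube integral_prod_cube, simp, rule f_int)+
  have g_cube: "integrable (restrict_space lborel unit_cube) (\<lambda>z :: real^'d. \<Prod>j\<in>UNIV. g \<mu> j (z $ j))"
    "(LINT z|restrict_space lborel unit_cube. (\<Prod>j\<in>UNIV. g \<mu> j ((z :: real^'d) $ j)))
      = (\<Prod>j\<in>UNIV. LINT t|lborel. indicator {0..<1} t *\<^sub>R g \<mu> j t)" for \<mu>
    unfolding unit_cube_eq
    by (rule integrable_prod_cube integral_prod_cube, simp, rule g_int)+
  have "(LINT t|lborel. indicator {0..<1} t *\<^sub>R f j t) = of_real ((u $ j) ^ r) * of_bool (k j = 0)" for j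
    using integral_cis_period[of "k j"] unfolding f_def e_def mult_scaleR_right[symmetric]
    by (simp del: mult_scaleR_right)
  then have "(\<Prod>j\<in>UNIV. LINT t|lborel. indicator {0..<1} t *\<^sub>R f j t) = (\<Prod>j\<in>UNIV. of_real ((u $ j) ^ r) * of_bool (k j = 0))"
    by simp
  \<comment> \<open>Only frequency zero survives, where \<open>hat_ft (u $ j) 0 = u $ j\<close>.
    This lets the kernel factor be taken out of the constant term as well.\<close>
  also have "\<dots> = of_real (\<Prod>j\<in>UNIV. hat_ft (u $ j) (k j) ^ r) * of_bool (k = (\<lambda>_. 0))"
  proof (cases "k = (\<lambda>_. 0)")
    case False
    then obtain j where "k j \<noteq> 0" by auto
    then have "(\<Prod>j\<in>UNIV. complex_of_real ((u $ j) ^ r) * of_bool (k j = 0)) = 0"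
      by (intro prod_zero) auto
    then show ?thesis using False by simp
  qed (simp add: hat_ft_def)
  finally have f_val: "(LINT z|restrict_space lborel unit_cube. (\<Prod>j\<in>UNIV. f j (z $ j)))
    = of_real (\<Prod>j\<in>UNIV. hat_ft (u $ j) (k j) ^ r) * of_bool (k = (\<lambda>_. 0))"
    by (simp only: f_cube(2))
  have g_val: "(LINT z|restrict_space lborel unit_cube. (\<Prod>j\<in>UNIV. g \<mu> j (z $ j)))
    = of_real (\<Prod>j\<in>UNIV. hat_ft (u $ j) (k j) ^ r) * (\<Prod>j\<in>UNIV. cis (- (2 * pi * of_int (k j) * \<xi> \<mu> $ j)))"
    if "\<mu> \<in> {1..m}" for \<mu>
  proof -
    have "(LINT t|lborel. indicator {0..<1} t *\<^sub>R g \<mu> j t)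
      = cis (- (2 * pi * of_int (k j) * \<xi> \<mu> $ j)) * of_real (hat_ft (u $ j) (k j) ^ r)" for j
      using periodized_hat_fourier[OF uj(1,2) r \<xi>j[OF that]] unfolding g_def e_def by simp
    then show ?thesis unfolding g_cube(2) by (simp add: prod.distrib mult.commute)
  qed
  have "of_real (product_error r m \<xi> w z u) * (\<Prod>j\<in>UNIV. e j (z $ j))
    = (\<Prod>j\<in>UNIV. f j (z $ j)) - (\<Sum>\<mu>=1..m. of_real (w \<mu>) * (\<Prod>j\<in>UNIV. g \<mu> j (z $ j)))" for z
    by (simp add: product_error_def f_def g_def prod.distrib left_diff_distrib sum_distrib_right mult.assoc)
  then have "(LINT z|restrict_space lborel unit_cube. of_real (product_error r m \<xi> w z u) * (\<Prod>j\<in>UNIV. e j (z $ j)))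
    = (LINT z|restrict_space lborel unit_cube. (\<Prod>j\<in>UNIV. f j (z $ j)))
      - (\<Sum>\<mu>=1..m. of_real (w \<mu>) * (LINT z|restrict_space lborel unit_cube. (\<Prod>j\<in>UNIV. g \<mu> j (z $ j))))"
    using f_cube(1) g_cube(1) by simp
  also have "\<dots> = of_real (\<Prod>j\<in>UNIV. hat_ft (u $ j) (k j) ^ r) * of_bool (k = (\<lambda>_. 0))
    - (\<Sum>\<mu>=1..m. of_real (w \<mu>) * (of_real (\<Prod>j\<in>UNIV. hat_ft (u $ j) (k j) ^ r) * (\<Prod>j\<in>UNIV. cis (- (2 * pi * of_int (k j) * \<xi> \<mu> $ j)))))"
    using f_val g_val by simp
  also have "\<dots> = of_real (\<Prod>j\<in>UNIV. hat_ft (u $ j) (k j) ^ r) * exp_sum_error m \<xi> w k"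
    by (simp add: exp_sum_error_def right_diff_distrib sum_distrib_left mult.left_commute)
  finally show ?thesis by (simp add: e_def)
qed

text \<open>Bessel's inequality for the exponentials on the unit cube, which are orthonormal; the
  kernel factor of each coefficient is real and appears squared.\<close>

lemma product_error_bessel:
  fixes u :: "real^'d" and F :: "('d \<Rightarrow> int) set"
  assumes u: "u \<in> half_cube" and \<xi>: "\<forall>\<mu>\<in>{1..m}. \<xi> \<mu> \<in> unit_cube" and r: "r \<ge> 1" and F: "finite F"
  shows "(\<Sum>k\<in>F. (norm (exp_sum_error m \<xi> w k))\<^sup>2 * (\<Prod>j\<in>UNIV. hat_ft (u $ j) (k j) ^ (2 * r)))
    \<le> (LINT z|restrict_space lborel unit_cube. (product_error r m \<xi> w z u)\<^sup>2)"
proof -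
  define e where "e k z = (\<Prod>j\<in>UNIV. cis (- (2 * pi * of_int (k j) * z $ j)))" for k :: "'d \<Rightarrow> int" and z :: "real^'d"
  have e_meas: "e k \<in> borel_measurable (restrict_space lborel unit_cube)" for k
  proof (rule measurable_restrict_space1)
    show "e k \<in> borel_measurable lborel" unfolding e_def[abs_def] cis_conv_exp by measurable
  qed
  have g_meas: "(\<lambda>z. product_error r m \<xi> w z u) \<in> borel_measurable (restrict_space lborel unit_cube)"
    by (intro measurable_restrict_space1 measurable_product_error) measurable
  have orth: "(LINT z|restrict_space lborel unit_cube. e k z * cnj (e l z)) = of_bool (k = l)" for k l
  proof -
    have "e k z * cnj (e l z) = (\<Prod>j\<in>UNIV. cis (- (2 * pi * of_int (k j - l j) * z $ j)))" for z
      by (simp add: e_def cis_cnj cis_mult prod.distrib[symmetric] algebra_simps)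
    then have "(LINT z|restrict_space lborel unit_cube. e k z * cnj (e l z))
      = (LINT z|restrict_space lborel unit_cube. (\<Prod>j\<in>UNIV. cis (- (2 * pi * of_int (k j - l j) * z $ j))))"
      by (simp only:)
    also have "\<dots> = (\<Prod>j\<in>UNIV. LINT t|lborel. indicator {0..<1} t *\<^sub>R cis (- (2 * pi * of_int (k j - l j) * t)))"
      unfolding unit_cube_eq
    proof (rule integral_prod_cube)
      show "integrable lborel (\<lambda>t. indicator {0..<1} t *\<^sub>R cis (- (2 * pi * of_int (k j - l j) * t)))" for j
        using integrable_cis_period[of "- (2 * pi * of_int (k j - l j))"] by simp
    qed simp
    also have "\<dots> = (\<Prod>j\<in>UNIV. of_bool (k j = l j))"
      by (simp only: integral_cis_period) simp
    also have "\<dots> = of_bool (k = l)"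
    proof (cases "k = l")
      case False
      then obtain j where "k j \<noteq> l j" by auto
      then have "(\<Prod>j\<in>UNIV. of_bool (k j = l j) :: complex) = 0" by (intro prod_zero) auto
      then show ?thesis using False by simp
    qed simp
    finally show ?thesis .
  qed
  have "(\<Sum>k\<in>F. (norm (LINT z|restrict_space lborel unit_cube. of_real (product_error r m \<xi> w z u) * e k z))\<^sup>2)
    \<le> (LINT z|restrict_space lborel unit_cube. (product_error r m \<xi> w z u)\<^sup>2)"
  proof (rule bessel_inequality[OF finite_measure_unit_cube F g_meas e_meas abs_product_error_le[OF u] _ orth])
    show "norm (e k x) \<le> 1" for k x by (simp add: e_def prod_norm[symmetric])
  qed
  moreover have "(norm (LINT z|restrict_space lborel unit_cube. of_real (product_error r m \<xi> w z u) * e k z))\<^sup>2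
    = (norm (exp_sum_error m \<xi> w k))\<^sup>2 * (\<Prod>j\<in>UNIV. hat_ft (u $ j) (k j) ^ (2 * r))" for k
    unfolding e_def product_error_fourier[OF u \<xi> r] norm_mult norm_of_real power_mult_distrib
    by (simp add: prod_power_distrib power_mult[symmetric] mult.commute)
  ultimately show ?thesis by simp
qed

section \<open>The lower bound\<close>

lemma measurable_hat_ft [measurable]: "(\<lambda>t. hat_ft t k) \<in> borel_measurable borel"
  unfolding hat_ft_def by (cases "k = 0") simp_all

lemma abs_hat_ft_le_1:
  assumes "0 < u" "u \<le> 1"
  shows "\<bar>hat_ft u k\<bar> \<le> 1"
proof (cases "k = 0")
  case False
  then have "1 \<le> \<bar>real_of_int k\<bar>" by (simp flip: of_int_abs)
  then have "1 * 1 \<le> pi * \<bar>real_of_int k\<bar>" using pi_ge_two by (intro mult_mono) auto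
  then have "\<bar>sin (pi * of_int k * u)\<bar> \<le> \<bar>pi * of_int k\<bar>"
    by (intro order_trans[OF abs_sin_le_one]) (simp add: abs_mult)
  then show ?thesis using False by (simp add: hat_ft_def abs_divide divide_le_eq_1)
qed (use assms in \<open>simp add: hat_ft_def\<close>)

lemma integrable_hat_ft_power: "integrable lborel (\<lambda>t. indicator {0<..1/2} t *\<^sub>R hat_ft t k ^ n)"
proof (rule integrable_indicator_bounded)
  show "norm (hat_ft t k ^ n) \<le> 1" if "t \<in> {0<..1/2}" for t
    using abs_hat_ft_le_1[of t k] that by (simp add: power_abs power_le_one)
qed auto

text \<open>For \<open>k \<noteq> 0\<close> and \<open>c = pi * k\<close> the integral is exactly
  \<open>1 / (4 * c\<^sup>2)\<close>, because the oscillating part vanishes at both ends;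
  \<open>pi < 4\<close> then gives the constant 64. For \<open>k = 0\<close> the integral is
  1/24.\<close>

lemma integral_hat_ft_square_ge:
  "(LINT t|lborel. indicator {0<..1/2} t * (hat_ft t k)\<^sup>2) \<ge> 1 / (64 * (max 1 \<bar>real_of_int k\<bar>)\<^sup>2)"
proof -
  have "AE t :: real in lborel. t \<noteq> 0" by (rule AE_lborel_singleton)
  then have eq: "(LINT t|lborel. indicator {0<..1/2} t * (hat_ft t k)\<^sup>2) = (LINT t|lborel. (hat_ft t k)\<^sup>2 * indicator {0..1/2} t)"
    by (intro integral_cong_AE) (auto simp: indicator_def elim!: eventually_mono)
  show ?thesis
  proof (cases "k = 0")
    case True
    have "(LINT t|lborel. t\<^sup>2 * indicator {0..1/2} t) = (1/2)^3 / 3 - 0 ^ 3 / (3 :: real)"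
    proof (rule integral_FTC_Icc_real)
      show "((\<lambda>x. x ^ 3 / 3) has_real_derivative x\<^sup>2) (at x)" for x :: real
        by (auto intro!: derivative_eq_intros simp: power2_eq_square)
    qed (auto intro!: continuous_intros)
    then show ?thesis unfolding eq using True by (simp add: hat_ft_def power3_eq_cube)
  next
    case False
    define c where "c = pi * real_of_int k"
    have c: "c \<noteq> 0" using False by (simp add: c_def)
    have deriv: "((\<lambda>t. (t / 2 - sin (2 * c * t) / (4 * c)) / c\<^sup>2) has_real_derivative (sin (c * t) / c)\<^sup>2) (at t)" for t
    proof -
      have "((\<lambda>t. (t / 2 - sin (2 * c * t) / (4 * c)) / c\<^sup>2) has_real_derivative (1 / 2 - cos (2 * (c * t)) / 2) / c\<^sup>2) (at t)"
        using c by (auto intro!: derivative_eq_intros simp: field_simps)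
      moreover have "(1 / 2 - cos (2 * (c * t)) / 2) / c\<^sup>2 = (sin (c * t) / c)\<^sup>2"
        by (simp add: cos_double_sin power_divide diff_divide_distrib)
      ultimately show ?thesis by (simp only:)
    qed
    have "(LINT t|lborel. (sin (c * t) / c)\<^sup>2 * indicator {0..1/2} t)
      = ((1/2) / 2 - sin (2 * c * (1/2)) / (4 * c)) / c\<^sup>2 - (0 / 2 - sin (2 * c * 0) / (4 * c)) / c\<^sup>2"
      using c by (intro integral_FTC_Icc_real deriv) (auto intro!: continuous_intros)
    also have "sin (2 * c * (1/2)) = 0" by (simp add: c_def sin_zero_iff_int2 mult.commute)
    finally have "(LINT t|lborel. (hat_ft t k)\<^sup>2 * indicator {0..1/2} t) = 1 / (4 * c\<^sup>2)"
      using False by (simp add: hat_ft_def c_def)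
    moreover have "max 1 \<bar>real_of_int k\<bar> = \<bar>real_of_int k\<bar>" using False by (simp flip: of_int_abs add: max_def)
    moreover have "pi\<^sup>2 \<le> 4\<^sup>2" using pi_less_4 by (intro power_mono) auto
    then have "4 * c\<^sup>2 \<le> 64 * (real_of_int k)\<^sup>2"
      by (simp add: c_def power_mult_distrib mult_right_mono)
    ultimately show ?thesis unfolding eq using c by (simp add: frac_le)
  qed
qed

text \<open>Jensen's inequality for \<open>x \<mapsto> x\<^sup>r\<close> through the tangent at \<open>a\<close>.\<close>

lemma integral_hat_ft_power_ge:
  assumes r: "r \<ge> 1"
  shows "(LINT t|lborel. indicator {0<..1/2} t *\<^sub>R hat_ft t k ^ (2 * r))
    \<ge> 1 / (2 * 32 ^ r * max 1 \<bar>real_of_int k\<bar> ^ (2 * r))"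
proof -
  \<comment> \<open>A lower bound for the mean of \<open>(hat_ft t k)\<^sup>2\<close> over the
    interval of length 1/2, by the case of squares.\<close>
  define a where "a = 1 / (32 * (max 1 \<bar>real_of_int k\<bar>)\<^sup>2)"
  have a: "a > 0" by (auto simp: a_def intro!: mult_pos_pos zero_less_power)
  define I where "I = (LINT t|lborel. indicator {0<..1/2} t * (hat_ft t k)\<^sup>2)"
  have I: "I \<ge> a / 2" using integral_hat_ft_square_ge[of k] by (simp add: I_def a_def)
  have tangent: "a ^ r + r * a ^ (r - 1) * (y - a) \<le> y ^ r" if "y \<ge> 0" for y
  proof -
    \<comment> \<open>Bernoulli's inequality for \<open>y / a - 1 \<ge> -1\<close>, rescaled by
      \<open>a ^ r\<close>, is the tangent inequality.\<close>
    have "1 + r * (y / a - 1) \<le> (1 + (y / a - 1)) ^ r"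
      using that a by (intro Bernoulli_inequality) simp
    then have "a ^ r * (1 + r * (y / a - 1)) \<le> a ^ r * (y / a) ^ r"
      using a by (intro mult_left_mono) auto
    moreover have "a ^ r * (y / a) ^ r = y ^ r" using a by (simp flip: power_mult_distrib)
    moreover have "a ^ r * (1 + r * (y / a - 1)) = a ^ r + r * a ^ (r - 1) * (y - a)"
    proof -
      have "a * b * (1 + r * (y / a - 1)) = a * b + r * b * (y - a)" for b :: real
        using a by (simp add: field_simps)
      moreover have "a ^ r = a * a ^ (r - 1)" using r by (simp flip: power_Suc)
      ultimately show ?thesis by (simp only:)
    qed
    ultimately show ?thesis by simp
  qed
  have int: "integrable lborel (\<lambda>t. indicator {0<..1/2} t *\<^sub>R (hat_ft t k)\<^sup>2)"
    "integrable lborel (indicator {0<..1/2} :: real \<Rightarrow> real)"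
    using integrable_hat_ft_power[of k 2] integrable_hat_ft_power[of k 0] by simp_all
  have "a ^ r / 2 \<le> a ^ r / 2 + r * a ^ (r - 1) * (I - a / 2)" using I a by simp
  also have "\<dots> = (a ^ r - r * a ^ (r - 1) * a) * (1/2) + r * a ^ (r - 1) * I"
    by (simp add: field_simps)
  also have "\<dots> = (LINT t|lborel. (a ^ r - r * a ^ (r - 1) * a) * indicator {0<..1/2} t
      + r * a ^ (r - 1) * (indicator {0<..1/2} t * (hat_ft t k)\<^sup>2))"
    using int by (simp add: I_def)
  also have "\<dots> \<le> (LINT t|lborel. indicator {0<..1/2} t *\<^sub>R hat_ft t k ^ (2 * r))"
  proof (rule integral_mono)
    show "(a ^ r - r * a ^ (r - 1) * a) * indicator {0<..1/2} t + r * a ^ (r - 1) * (indicator {0<..1/2} t * (hat_ft t k)\<^sup>2)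
      \<le> indicator {0<..1/2} t *\<^sub>R hat_ft t k ^ (2 * r)" for t
      using tangent[of "(hat_ft t k)\<^sup>2"] by (simp add: indicator_def power_mult right_diff_distrib)
  qed (use int integrable_hat_ft_power in auto)
  finally have "a ^ r / 2 \<le> (LINT t|lborel. indicator {0<..1/2} t *\<^sub>R hat_ft t k ^ (2 * r))" .
  moreover have "a ^ r / 2 = 1 / (2 * 32 ^ r * max 1 \<bar>real_of_int k\<bar> ^ (2 * r))"
    by (simp add: a_def power_divide power_mult_distrib power_mult)
  ultimately show ?thesis by simp
qed

section \<open>From the discrepancy to weighted Fourier coefficients\<close>

lemma Lp_norm_2: "Lp_norm M 2 f = sqrt (LINT x|M. (f x)\<^sup>2)"
proof -
  have "\<bar>f x\<bar> powr 2 = (f x)\<^sup>2" for x by (simp add: powr_numeral)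
  then show ?thesis by (simp add: Lp_norm_def powr_half_sqrt)
qed

lemma periodic_discrepancy_eq:
  fixes \<xi> :: "nat \<Rightarrow> real^'d"
  assumes \<xi>: "\<forall>\<mu>\<in>{1..m}. \<xi> \<mu> \<in> unit_cube" and r: "r \<ge> 1"
  shows "periodic_discrepancy r 2 2 m \<xi> w = sqrt (LINT u|restrict_space lborel half_cube.
    LINT z|restrict_space lborel unit_cube. (product_error r m \<xi> w z u)\<^sup>2)"
proof -
  have "(LINT u|restrict_space lborel half_cube. LINT z|restrict_space lborel unit_cube. (cubature_error r m \<xi> w z u)\<^sup>2)
    = (LINT u|restrict_space lborel half_cube. LINT z|restrict_space lborel unit_cube. (product_error r m \<xi> w z u)\<^sup>2)"
    using cubature_error_eq[OF _ _ \<xi> r]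
    by (intro Bochner_Integration.integral_cong refl) (simp add: space_restrict_space)
  then show ?thesis unfolding periodic_discrepancy_def Lp_norm_2 by simp
qed

text \<open>Needed for the monotonicity of the integral over \<open>u\<close>: a Bochner integral of
  a function that is not integrable would be 0.\<close>

lemma integrable_product_error:
  fixes \<xi> :: "nat \<Rightarrow> real^'d"
  shows "integrable (restrict_space lborel half_cube)
    (\<lambda>u. LINT z|restrict_space lborel unit_cube. (product_error r m \<xi> w z u)\<^sup>2)"
proof -
  let ?U = "restrict_space lborel (unit_cube :: (real^'d) set)"
  let ?H = "restrict_space lborel (half_cube :: (real^'d) set)"
  interpret U: finite_measure ?U by (rule finite_measure_unit_cube)
  interpret H: finite_measure ?H by (rule finite_measure_half_cube)
  define B where "B = 1 + (\<Sum>\<mu>=1..m. \<bar>w \<mu>\<bar>) * (2 * real r + 3) ^ CARD('d)"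
  have nth: "(\<lambda>x. x $ j) \<in> borel_measurable ?U" "(\<lambda>x. x $ j) \<in> borel_measurable ?H" for j
    by (intro measurable_restrict_space1; measurable)+
  have "(\<lambda>p. product_error r m \<xi> w (snd p) (fst p)) \<in> borel_measurable (?H \<Otimes>\<^sub>M ?U)"
    by (intro measurable_product_error measurable_compose[OF measurable_fst nth(2)] measurable_compose[OF measurable_snd nth(1)])
  then have "(\<lambda>(u, z). (product_error r m \<xi> w z u)\<^sup>2) \<in> borel_measurable (?H \<Otimes>\<^sub>M ?U)"
    unfolding split_def by (rule borel_measurable_power)
  then have meas: "(\<lambda>u. LINT z|?U. (product_error r m \<xi> w z u)\<^sup>2) \<in> borel_measurable ?H"
    by (rule U.borel_measurable_lebesgue_integral)
  show ?thesis
  proof (rule H.integrable_const_bound[OF _ meas], rule AE_I2)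
    fix u :: "real^'d" assume "u \<in> space ?H"
    then have u: "u \<in> half_cube" by (simp add: space_restrict_space)
    have le: "(product_error r m \<xi> w z u)\<^sup>2 \<le> B\<^sup>2" for z
      using abs_product_error_le[OF u, of r m \<xi> w z] unfolding B_def by (rule abs_le_square_iff[THEN iffD1, OF order_trans[OF _ abs_ge_self]])
    have "(LINT z|?U. (product_error r m \<xi> w z u)\<^sup>2) \<le> (LINT z|?U. B\<^sup>2)"
      using le by (intro integral_mono') auto
    then show "norm (LINT z|?U. (product_error r m \<xi> w z u)\<^sup>2) \<le> (LINT z|?U. B\<^sup>2)" by simp
  qed
qed

text \<open>Bessel's inequality is integrated over \<open>u\<close>. The integral of each kernel
  factor splits over the coordinates, and the bounds in the single coordinates multiply to the power
  of \<open>freq_weight\<close> and to the constant.\<close>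

lemma discrepancy_ge_exp_sum_error:
  fixes \<xi> :: "nat \<Rightarrow> real^'d" and F :: "('d \<Rightarrow> int) set"
  assumes \<xi>: "\<forall>\<mu>\<in>{1..m}. \<xi> \<mu> \<in> unit_cube" and r: "r \<ge> 1" and F: "finite F"
  shows "(\<Sum>k\<in>F. (norm (exp_sum_error m \<xi> w k))\<^sup>2 / freq_weight k ^ (2 * r)) / (2 * 32 ^ r) ^ CARD('d)
    \<le> (LINT u|restrict_space lborel half_cube. LINT z|restrict_space lborel unit_cube. (product_error r m \<xi> w z u)\<^sup>2)"
proof -
  let ?H = "restrict_space lborel (half_cube :: (real^'d) set)"
  define G where "G k u = (\<Prod>j\<in>UNIV. hat_ft (u $ j) (k j) ^ (2 * r))" for k :: "'d \<Rightarrow> int" and u :: "real^'d"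
  have G: "integrable ?H (G k)" "(LINT u|?H. G k u) = (\<Prod>j\<in>UNIV. LINT t|lborel. indicator {0<..1/2} t *\<^sub>R hat_ft t (k j) ^ (2 * r))" for k
    unfolding half_cube_eq G_def
    by (rule integrable_prod_cube[where f = "\<lambda>j t. hat_ft t (k j) ^ (2 * r)"]
        integral_prod_cube[where f = "\<lambda>j t. hat_ft t (k j) ^ (2 * r)"], simp, rule integrable_hat_ft_power)+
  have G_ge: "1 / freq_weight k ^ (2 * r) / (2 * 32 ^ r) ^ CARD('d) \<le> (LINT u|?H. G k u)" for k
  proof -
    have "1 / freq_weight k ^ (2 * r) / (2 * 32 ^ r) ^ CARD('d)
      = (\<Prod>j\<in>UNIV. 1 / (2 * 32 ^ r * max 1 \<bar>real_of_int (k j)\<bar> ^ (2 * r)))"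
      by (simp add: freq_weight_def prod_dividef prod.distrib prod_power_distrib mult.commute)
    also have "\<dots> \<le> (LINT u|?H. G k u)"
      unfolding G(2) using integral_hat_ft_power_ge[OF r] by (intro prod_mono) auto
    finally show ?thesis .
  qed
  have "(\<Sum>k\<in>F. (norm (exp_sum_error m \<xi> w k))\<^sup>2 / freq_weight k ^ (2 * r)) / (2 * 32 ^ r) ^ CARD('d)
    = (\<Sum>k\<in>F. (norm (exp_sum_error m \<xi> w k))\<^sup>2 * (1 / freq_weight k ^ (2 * r) / (2 * 32 ^ r) ^ CARD('d)))"
    by (simp add: sum_divide_distrib)
  also have "\<dots> \<le> (\<Sum>k\<in>F. (norm (exp_sum_error m \<xi> w k))\<^sup>2 * (LINT u|?H. G k u))"
    by (intro sum_mono mult_left_mono G_ge) simp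
  also have "\<dots> = (LINT u|?H. (\<Sum>k\<in>F. (norm (exp_sum_error m \<xi> w k))\<^sup>2 * G k u))"
    using G(1) by simp
  also have "\<dots> \<le> (LINT u|?H. LINT z|restrict_space lborel unit_cube. (product_error r m \<xi> w z u)\<^sup>2)"
  proof (rule integral_mono)
    show "integrable ?H (\<lambda>u. \<Sum>k\<in>F. (norm (exp_sum_error m \<xi> w k))\<^sup>2 * G k u)" using G(1) by simp
    show "(\<Sum>k\<in>F. (norm (exp_sum_error m \<xi> w k))\<^sup>2 * G k u)
      \<le> (LINT z|restrict_space lborel unit_cube. (product_error r m \<xi> w z u)\<^sup>2)" if "u \<in> space ?H" for u
      using product_error_bessel[OF _ \<xi> r F] that by (simp add: G_def space_restrict_space)
  qed (rule integrable_product_error)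
  finally show ?thesis .
qed

section \<open>Summation over boxes and choice of the box volume\<close>

lemma prod_cis: "(\<Prod>j\<in>A. cis (f j)) = cis (\<Sum>j\<in>A. f j)"
  by (induction A rule: infinite_finite_induct) (simp_all add: cis_mult)

text \<open>The real parts of the coefficients are the entries in the rank argument, and they do not
  exceed the moduli in absolute value.\<close>

lemma sum_freq_box_exp_sum_error_ge:
  fixes \<xi> :: "nat \<Rightarrow> real^'d"
  assumes "4 * m \<le> 2 ^ (\<Sum>j\<in>UNIV. s j)"
  shows "(\<Sum>k\<in>freq_box s. (norm (exp_sum_error m \<xi> w k))\<^sup>2) \<ge> 1 / 2"
proof -
  have Re: "Re (exp_sum_error m \<xi> w k) = of_bool (k = (\<lambda>_. 0)) -
    (\<Sum>\<mu>=1..m. w \<mu> * cos (2 * pi * (\<Sum>j\<in>UNIV. of_int (k j) * \<xi> \<mu> $ j)))" for k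
    by (simp add: exp_sum_error_def prod_cis sum_negf mult.assoc flip: sum_distrib_left)
  have "1 / 2 \<le> (\<Sum>k\<in>freq_box s. (Re (exp_sum_error m \<xi> w k))\<^sup>2)"
    unfolding Re by (rule sum_freq_box_ge_half[OF assms])
  also have "\<dots> \<le> (\<Sum>k\<in>freq_box s. (norm (exp_sum_error m \<xi> w k))\<^sup>2)"
    by (intro sum_mono) (simp add: cmod_power2)
  finally show ?thesis .
qed

text \<open>The bound 1/2 for each box is added up over all compositions of \<open>n\<close>. After
  exchanging the sums, every frequency is counted once for each box containing it, and that number
  is controlled by its weight.\<close>

lemma weighted_exp_sum_error_ge:
  fixes \<xi> :: "nat \<Rightarrow> real^'d"
  assumes "4 * m \<le> 2 ^ n" and r: "r \<ge> 1"
  obtains F :: "('d \<Rightarrow> int) set" where "finite F"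
    "real (card (compositions n :: ('d \<Rightarrow> nat) set)) / (2 * 2 ^ CARD('d) * (2 ^ n) ^ (2 * r))
      \<le> (\<Sum>k\<in>F. (norm (exp_sum_error m \<xi> w k))\<^sup>2 / freq_weight k ^ (2 * r))"
proof
  define S where "S = (compositions n :: ('d \<Rightarrow> nat) set)"
  define F where "F = (\<Union>s\<in>S. freq_box s)"
  define \<rho> where "\<rho> k = (norm (exp_sum_error m \<xi> w k))\<^sup>2" for k
  show fin: "finite F" by (auto simp: F_def S_def finite_compositions finite_freq_box)
  have weight: "freq_weight k > 0" for k :: "'d \<Rightarrow> int"
    unfolding freq_weight_def by (intro prod_pos less_le_trans[OF zero_less_one max.cobounded1])
  have "real (card S) / 2 = (\<Sum>s\<in>S. 1 / 2)" by simp
  also have "\<dots> \<le> (\<Sum>s\<in>S. \<Sum>k\<in>freq_box s. \<rho> k)"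
    unfolding \<rho>_def using assms(1) by (intro sum_mono sum_freq_box_exp_sum_error_ge) (simp add: S_def compositions_def)
  also have "\<dots> = (\<Sum>s\<in>S. \<Sum>k\<in>F. \<rho> k * of_bool (k \<in> freq_box s))"
  proof (rule sum.cong[OF refl])
    fix s assume "s \<in> S"
    then show "(\<Sum>k\<in>freq_box s. \<rho> k) = (\<Sum>k\<in>F. \<rho> k * of_bool (k \<in> freq_box s))"
      by (intro sum.mono_neutral_cong_left fin) (auto simp: F_def)
  qed
  also have "\<dots> = (\<Sum>k\<in>F. \<rho> k * (\<Sum>s\<in>S. of_bool (k \<in> freq_box s)))"
    by (subst sum.swap) (simp add: sum_distrib_left)
  also have "\<dots> \<le> (\<Sum>k\<in>F. \<rho> k * (2 ^ CARD('d) * (2 ^ n) ^ (2 * r) / freq_weight k ^ (2 * r)))"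
  proof (intro sum_mono mult_left_mono)
    fix k :: "'d \<Rightarrow> int"
    show "(\<Sum>s\<in>S. of_bool (k \<in> freq_box s)) \<le> 2 ^ CARD('d) * (2 ^ n) ^ (2 * r) / freq_weight k ^ (2 * r)"
      using sum_compositions_freq_box_le[OF r, where n = n and k = k] weight[of k]
      unfolding S_def freq_weight_def by (subst pos_le_divide_eq) simp_all
  qed (simp add: \<rho>_def)
  also have "\<dots> = 2 ^ CARD('d) * (2 ^ n) ^ (2 * r) * (\<Sum>k\<in>F. \<rho> k / freq_weight k ^ (2 * r))"
    by (simp add: sum_distrib_left mult_ac)
  finally show "real (card (compositions n :: ('d \<Rightarrow> nat) set)) / (2 * 2 ^ CARD('d) * (2 ^ n) ^ (2 * r))
      \<le> (\<Sum>k\<in>F. (norm (exp_sum_error m \<xi> w k))\<^sup>2 / freq_weight k ^ (2 * r))"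
    by (simp add: S_def \<rho>_def field_simps)
qed

theorem theorem3p1:
  fixes r :: nat
  assumes "r \<ge> 1" and "CARD('d::finite) \<ge> 2"
  shows "\<exists>C::real. C > 0 \<and>
    (\<forall>m::nat. m \<ge> 1 \<longrightarrow>
      (\<forall>(\<xi> :: nat \<Rightarrow> real^'d) (w :: nat \<Rightarrow> real).
        (\<forall>\<mu>\<in>{1..m}. \<xi> \<mu> \<in> unit_cube) \<longrightarrow>
        periodic_discrepancy r 2 2 m \<xi> w
          \<ge> C * real m powr (- real r) * ln (real m) powr ((real CARD('d) - 1) / 2)))"
proof -
  define d where "d = CARD('d)"
  have d: "d \<ge> 2" using assms(2) by (simp add: d_def)
  \<comment> \<open>The factors come from: the number of compositions, at least
    \<open>(n / d) ^ (d - 1)\<close>; the bound 1/2 per box; the geometric series,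
    \<open>2 ^ d\<close>; the inequality \<open>2 ^ n \<le> 8 * m\<close>; the integration over
    \<open>u\<close>.\<close>
  define c where "c = 1 / (real d ^ (d - 1) * (2 * 2 ^ d * 8 ^ (2 * r)) * (2 * 32 ^ r) ^ d)"
  have c: "c > 0" using d by (simp add: c_def)
  have "periodic_discrepancy r 2 2 m \<xi> w \<ge> sqrt c * real m powr (- real r) * ln (real m) powr ((real d - 1) / 2)"
    if m: "m \<ge> 1" and \<xi>: "\<forall>\<mu>\<in>{1..m}. \<xi> \<mu> \<in> unit_cube" for m w and \<xi> :: "nat \<Rightarrow> real^'d"
  proof -
    obtain p where p: "2 ^ p \<le> m" "m < 2 ^ (p + 1)" using ex_power_ivl1[of 2 m] m by auto
    \<comment> \<open>The offset 3 is what \<open>4 * m \<le> 2 ^ n \<le> 8 * m\<close> requires: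
      the lower bound is the hypothesis of the rank argument, the upper one keeps
      \<open>2 ^ n\<close> of order \<open>m\<close>.\<close>
    define n where "n = p + 3"
    have n: "4 * m \<le> 2 ^ n" "2 ^ n \<le> 8 * m" using p by (simp_all add: n_def power_add)
    have "real m \<le> real (2 ^ (p + 1))" using p(2) by (simp only: of_nat_le_iff less_imp_le)
    then have "ln (real m) \<le> ln (2 ^ (p + 1))" using m by simp
    also have "\<dots> = (p + 1) * ln 2" by (rule ln_realpow)
    also have "\<dots> \<le> real (p + 1) * 1" using ln_le_minus_one[of "2 :: real"] by (intro mult_left_mono) auto
    also have "\<dots> \<le> real n" by (simp add: n_def)
    finally have ln_le: "ln (real m) \<le> real n" .
    have "n \<le> (n div d + 1) * d"
      using div_mult_mod_eq[of n d] mod_less_divisor[of d n] d unfolding add_mult_distrib by linarith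
    then have "real n \<le> real (n div d + 1) * real d" by (simp only: of_nat_le_iff flip: of_nat_mult)
    then have div_le: "real n / d \<le> real (n div d + 1)" using d by (simp add: pos_divide_le_eq)
    have "ln (real m) / d \<le> real n / d" using ln_le by (intro divide_right_mono) auto
    also note div_le
    finally have "(ln (real m) / d) ^ (d - 1) \<le> real (n div d + 1) ^ (d - 1)"
      using m by (intro power_mono) auto
    also have "\<dots> = real ((n div d + 1) ^ (d - 1))" by simp
    also have "\<dots> \<le> real (card (compositions n :: ('d \<Rightarrow> nat) set))"
      using card_compositions_ge[of n, where 'd = 'd] unfolding d_def by (simp only: of_nat_le_iff)
    finally have card_ge: "(ln (real m) / d) ^ (d - 1) \<le> real (card (compositions n :: ('d \<Rightarrow> nat) set))" .
    have pow_le: "(2 ^ n) ^ (2 * r) \<le> (8 * real m) ^ (2 * r)"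
      using of_nat_mono[OF n(2), where 'a = real] by (intro power_mono) simp_all
    obtain F :: "('d \<Rightarrow> int) set" where F: "finite F"
      "real (card (compositions n :: ('d \<Rightarrow> nat) set)) / (2 * 2 ^ d * (2 ^ n) ^ (2 * r))
        \<le> (\<Sum>k\<in>F. (norm (exp_sum_error m \<xi> w k))\<^sup>2 / freq_weight k ^ (2 * r))"
      using weighted_exp_sum_error_ge[OF n(1) assms(1), of \<xi> w] unfolding d_def by blast
    have m_sq: "(real m powr (- real r))\<^sup>2 = 1 / real m ^ (2 * r)"
      using m by (simp add: powr_minus powr_realpow power_mult[symmetric] mult.commute divide_inverse power_inverse)
    have ln_sq: "(ln (real m) powr ((real d - 1) / 2))\<^sup>2 = ln (real m) ^ (d - 1)"
    \<comment> \<open>For \<open>m = 1\<close> the logarithm is 0 and so are both sides, the right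
      one because \<open>d \<ge> 2\<close>.\<close>
    proof (cases "m = 1")
      case False
      then have "ln (real m) > 0" using m by simp
      then have "(ln (real m) powr ((real d - 1) / 2))\<^sup>2 = ln (real m) powr real (d - 1)"
        using d by (simp add: power2_eq_square of_nat_diff flip: powr_add)
      then show ?thesis using \<open>ln (real m) > 0\<close> by (simp add: powr_realpow)
    qed (use d in simp)
    \<comment> \<open>The squared claim is compared with the squared discrepancy, which is the
      double integral.\<close>
    have "(sqrt c * real m powr (- real r) * ln (real m) powr ((real d - 1) / 2))\<^sup>2
      = c * (1 / real m ^ (2 * r)) * ln (real m) ^ (d - 1)"
      using c by (simp add: power_mult_distrib m_sq ln_sq)
    also have "\<dots> = (ln (real m) / d) ^ (d - 1) / (2 * 2 ^ d * (8 * real m) ^ (2 * r)) / (2 * 32 ^ r) ^ d"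
      by (simp add: c_def power_divide power_mult_distrib)
    also have "\<dots> \<le> real (card (compositions n :: ('d \<Rightarrow> nat) set)) / (2 * 2 ^ d * (2 ^ n) ^ (2 * r)) / (2 * 32 ^ r) ^ d"
      using m card_ge pow_le by (intro divide_right_mono frac_le) auto
    also have "\<dots> \<le> (\<Sum>k\<in>F. (norm (exp_sum_error m \<xi> w k))\<^sup>2 / freq_weight k ^ (2 * r)) / (2 * 32 ^ r) ^ d"
      using F(2) by (intro divide_right_mono) auto
    also have "\<dots> \<le> (LINT u|restrict_space lborel half_cube. LINT z|restrict_space lborel unit_cube. (product_error r m \<xi> w z u)\<^sup>2)"
      unfolding d_def by (rule discrepancy_ge_exp_sum_error[OF \<xi> assms(1) F(1)])
    finally show ?thesis
      unfolding periodic_discrepancy_eq[OF \<xi> assms(1)] by (rule real_le_rsqrt)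
  qed
  then show ?thesis using c unfolding d_def by (intro exI[of _ "sqrt c"]) auto
qed

end
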